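(* Let $H$ be a Hopf algebra over a field $\mathbb{K}$ with non-zero integrals. Then $H\simeq (H^{*rat})^0$ as coalgebras.
   Context: $H^*$ is the dual algebra of the coalgebra $H$, with convolution product. A left integral on $H$ is an element $t\in H^*$ such that $h^*t=h^*(1)t$ for all $h^*\in H^*$ (right integrals are defined symmetrically); $H$ has non-zero integrals if there is a non-zero left integral on $H$ (equivalently, a non-zero right integral). $H^{*rat}=Rat({}_{H^*}H^* )$ is the rational part of $H^*$ as a left $H^*$-module, i.e. the set of $m\in H^*$ for which there are finitely many $m_i\in H^*$, $c_i\in H$ with $h^*m=\sum_i h^*(c_i)m_i$ for all $h^*\in H^*$ (for $H$ with non-zero integrals it coincides with the right rational part). It is a two-sided ideal of $H^*$ and is regarded as a not necessarily unital algebra. For a not necessarily unital algebra $A$, the finite dual $A^0$ is the set of $f\in A^*$ such that $\ker f$ contains a two-sided ideal of $A$ of finite codimension. It is a coalgebra with comultiplication $f\mapsto\sum_j g_j\otimes h_j$, where $g_j,h_j\in A^0$ satisfy $f(ab)=\sum_j g_j(a)h_j(b)$ for all $a,b\in A$. *)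

theory Defs
  imports Complex_Main "HOL-Library.Poly_Mapping" "HOL-Library.Function_Algebras"
begin

section \<open>Vector spaces of formal sums and of functions\<close>

definition fs_scale :: "'k::field \<Rightarrow> ('a \<Rightarrow>\<^sub>0 'k) \<Rightarrow> ('a \<Rightarrow>\<^sub>0 'k)" where
  "fs_scale k = Poly_Mapping.map ((*) k)"

definition fun_scale :: "'k::field \<Rightarrow> ('a \<Rightarrow> 'k) \<Rightarrow> ('a \<Rightarrow> 'k)" where
  "fun_scale k f = (\<lambda>a. k * f a)"

lemma lookup_fs_scale [simp]:
  "Poly_Mapping.lookup (fs_scale k x) a = k * Poly_Mapping.lookup x a"
  by (simp add: fs_scale_def map.rep_eq when_def)

lemma vector_space_fs_scale: "vector_space (fs_scale :: 'k::field \<Rightarrow> ('a \<Rightarrow>\<^sub>0 'k) \<Rightarrow> _)"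
  by unfold_locales (auto intro!: poly_mapping_eqI simp: lookup_add algebra_simps)

lemma vector_space_fun_scale: "vector_space (fun_scale :: 'k::field \<Rightarrow> ('a \<Rightarrow> 'k) \<Rightarrow> _)"
  by unfold_locales (auto simp: fun_scale_def algebra_simps)

lemma vector_space_field: "vector_space ((*) :: 'k::field \<Rightarrow> 'k \<Rightarrow> 'k)"
  by unfold_locales (auto simp: algebra_simps)

text \<open>The free vector space on a set \<open>X\<close>.\<close>

definition formal :: "'a set \<Rightarrow> ('a \<Rightarrow>\<^sub>0 'k::field) set" where
  "formal X = {x. Poly_Mapping.keys x \<subseteq> X}"

text \<open>The linear extension of a map \<open>F\<close> on generators to formal sums, with values in a vector space
  with scalar multiplication \<open>s\<close>.\<close>

definition lin_ext ::
    "('k::field \<Rightarrow> 'v::ab_group_add \<Rightarrow> 'v) \<Rightarrow> ('a \<Rightarrow> 'v) \<Rightarrow> ('a \<Rightarrow>\<^sub>0 'k) \<Rightarrow> 'v" where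
  "lin_ext s F x = (\<Sum>a\<in>Poly_Mapping.keys x. s (Poly_Mapping.lookup x a) (F a))"

abbreviation gen :: "'a \<Rightarrow> ('a \<Rightarrow>\<^sub>0 'k::field)" where
  "gen a \<equiv> Poly_Mapping.single a 1"

section \<open>Tensor squares and cubes\<close>

text \<open>
  Let \<open>C\<close> be a subspace of a vector space with scalar multiplication \<open>s\<close>. The tensor square
  of \<open>C\<close> is the free vector space on \<open>C \<times> C\<close> modulo the span of the bilinearity relators, so
  its elements are classes of formal sums; the cube is treated likewise with triples.
  In \<open>slot_rel\<close>, \<open>e\<close> inserts an element of \<open>C\<close> into one slot of a pure tensor.
\<close>

definition slot_rel ::
    "('k::field \<Rightarrow> 'c::ab_group_add \<Rightarrow> 'c) \<Rightarrow> 'c set \<Rightarrow> ('c \<Rightarrow> 'a) \<Rightarrow> ('a \<Rightarrow>\<^sub>0 'k) set" where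
  "slot_rel s C e =
     {gen (e (a + b)) - gen (e a) - gen (e b) | a b. a \<in> C \<and> b \<in> C}
   \<union> {gen (e (s k a)) - fs_scale k (gen (e a)) | k a. a \<in> C}"

definition tensor2_rel ::
    "('k::field \<Rightarrow> 'c::ab_group_add \<Rightarrow> 'c) \<Rightarrow> 'c set \<Rightarrow> ('c \<times> 'c \<Rightarrow>\<^sub>0 'k) set" where
  "tensor2_rel s C = (\<Union>u\<in>C. slot_rel s C (\<lambda>a. (a, u)) \<union> slot_rel s C (\<lambda>a. (u, a)))"

definition tensor3_rel ::
    "('k::field \<Rightarrow> 'c::ab_group_add \<Rightarrow> 'c) \<Rightarrow> 'c set \<Rightarrow> ('c \<times> 'c \<times> 'c \<Rightarrow>\<^sub>0 'k) set" where
  "tensor3_rel s C = (\<Union>u\<in>C. \<Union>v\<in>C.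
     slot_rel s C (\<lambda>a. (a, u, v)) \<union> slot_rel s C (\<lambda>a. (u, a, v)) \<union> slot_rel s C (\<lambda>a. (u, v, a)))"

definition tensor2_eq ::
    "('k::field \<Rightarrow> 'c::ab_group_add \<Rightarrow> 'c) \<Rightarrow> 'c set \<Rightarrow> (('c \<times> 'c \<Rightarrow>\<^sub>0 'k) \<times> ('c \<times> 'c \<Rightarrow>\<^sub>0 'k)) set" where
  "tensor2_eq s C = {(x, y). x \<in> formal (C \<times> C) \<and> y \<in> formal (C \<times> C)
     \<and> x - y \<in> module.span fs_scale (tensor2_rel s C)}"

definition tensor3_eq ::
    "('k::field \<Rightarrow> 'c::ab_group_add \<Rightarrow> 'c) \<Rightarrow> 'c set
       \<Rightarrow> (('c \<times> 'c \<times> 'c \<Rightarrow>\<^sub>0 'k) \<times> ('c \<times> 'c \<times> 'c \<Rightarrow>\<^sub>0 'k)) set" where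
  "tensor3_eq s C = {(x, y). x \<in> formal (C \<times> C \<times> C) \<and> y \<in> formal (C \<times> C \<times> C)
     \<and> x - y \<in> module.span fs_scale (tensor3_rel s C)}"

definition tensor2 ::
    "('k::field \<Rightarrow> 'c::ab_group_add \<Rightarrow> 'c) \<Rightarrow> 'c set \<Rightarrow> ('c \<times> 'c \<Rightarrow>\<^sub>0 'k) set set" where
  "tensor2 s C = formal (C \<times> C) // tensor2_eq s C"

text \<open>The value of the linear map on a tensor square induced by a bilinear map \<open>F\<close>, computed on some
  representative; for bilinear \<open>F\<close> the choice is irrelevant (\<open>lin_ext_tensor2_cong\<close> below).\<close>

definition tensor2_lift ::
    "('k::field \<Rightarrow> 'v::ab_group_add \<Rightarrow> 'v) \<Rightarrow> ('a \<Rightarrow> 'v) \<Rightarrow> ('a \<Rightarrow>\<^sub>0 'k) set \<Rightarrow> 'v" where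
  "tensor2_lift s F X = lin_ext s F (SOME x. x \<in> X)"

lemma lin_ext_superset:
  assumes "vector_space s" "finite A" "Poly_Mapping.keys x \<subseteq> A"
  shows "lin_ext s F x = (\<Sum>a\<in>A. s (Poly_Mapping.lookup x a) (F a))"
proof -
  interpret vector_space s by fact
  show ?thesis unfolding lin_ext_def
    by (rule sum.mono_neutral_left) (use assms in \<open>auto simp: in_keys_iff\<close>)
qed

lemma lin_ext_gen: "vector_space s \<Longrightarrow> lin_ext s F (gen a) = F a"
  by (simp add: lin_ext_def vector_space_def)

lemma lin_ext_add:
  assumes "vector_space s" shows "lin_ext s F (x + y) = lin_ext s F x + lin_ext s F y"
proof -
  interpret vector_space s by fact
  let ?A = "Poly_Mapping.keys x \<union> Poly_Mapping.keys y \<union> Poly_Mapping.keys (x + y)"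
  have "lin_ext s F z = (\<Sum>a\<in>?A. s (Poly_Mapping.lookup z a) (F a))" if "z \<in> {x, y, x + y}" for z
    using assms that by (intro lin_ext_superset) auto
  then show ?thesis by (simp add: lookup_add scale_left_distrib sum.distrib)
qed

lemma lin_ext_scale:
  assumes "vector_space s" shows "lin_ext s F (fs_scale k x) = s k (lin_ext s F x)"
proof -
  interpret vector_space s by fact
  have "lin_ext s F z = (\<Sum>a\<in>Poly_Mapping.keys x. s (Poly_Mapping.lookup z a) (F a))"
    if "z \<in> {x, fs_scale k x}" for z
    using assms that by (intro lin_ext_superset) (auto simp: in_keys_iff)
  then show ?thesis by (simp add: scale_sum_right)
qed

lemma linear_lin_ext:
  assumes "vector_space s" shows "Vector_Spaces.linear fs_scale s (lin_ext s F)"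
  using assms by (simp add: Vector_Spaces.linear_iff vector_space_fs_scale lin_ext_add lin_ext_scale)

lemma equiv_tensor2_eq:
  fixes s :: "'k::field \<Rightarrow> 'c::ab_group_add \<Rightarrow> 'c"
  shows "equiv (formal (C \<times> C)) (tensor2_eq s C)"
proof -
  interpret V: vector_space "fs_scale :: 'k \<Rightarrow> ('c \<times> 'c \<Rightarrow>\<^sub>0 'k) \<Rightarrow> _"
    by (rule vector_space_fs_scale)
  show ?thesis
  proof (rule equivI)
    show "tensor2_eq s C \<subseteq> formal (C \<times> C) \<times> formal (C \<times> C)"
      by (auto simp: tensor2_eq_def)
    show "refl_on (formal (C \<times> C)) (tensor2_eq s C)"
      by (auto simp: refl_on_def tensor2_eq_def V.span_zero)
    show "sym (tensor2_eq s C)"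
      by (rule symI) (auto simp: tensor2_eq_def dest: V.span_neg)
    show "trans (tensor2_eq s C)"
      by (rule transI) (auto simp: tensor2_eq_def dest: V.span_add)
  qed
qed

lemma lin_ext_tensor2_cong:
  assumes s: "vector_space s"
    and add: "\<And>a b c. a \<in> C \<Longrightarrow> b \<in> C \<Longrightarrow> c \<in> C \<Longrightarrow>
          F (a + b, c) = F (a, c) + F (b, c) \<and> F (c, a + b) = F (c, a) + F (c, b)"
    and scale: "\<And>k a c. a \<in> C \<Longrightarrow> c \<in> C \<Longrightarrow>
          F (t k a, c) = s k (F (a, c)) \<and> F (c, t k a) = s k (F (c, a))"
    and X: "X \<in> tensor2 t C" "x \<in> X" "y \<in> X"
  shows "lin_ext s F x = lin_ext s F y"
proof -
  interpret L: Vector_Spaces.linear fs_scale s "lin_ext s F" by (rule linear_lin_ext[OF s])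
  have "(x, y) \<in> tensor2_eq t C"
    using X quotient_eq_iff[OF equiv_tensor2_eq] unfolding tensor2_def by blast
  then have "x - y \<in> module.span fs_scale (tensor2_rel t C)"
    by (simp add: tensor2_eq_def)
  then have "lin_ext s F (x - y) = 0"
  proof (rule L.eq_0_on_span[rotated])
    show "lin_ext s F z = 0" if "z \<in> tensor2_rel t C" for z
      using that add scale
      by (auto simp: tensor2_rel_def slot_rel_def L.diff lin_ext_scale[OF s] lin_ext_gen[OF s])
  qed
  then show ?thesis by (simp add: L.diff)
qed

section \<open>Coalgebras\<close>

text \<open>
  A coalgebra with underlying space a subspace \<open>C\<close>. The statement \<open>x \<in> \<Delta> c\<close> says that the
  formal sum \<open>x\<close> of pairs represents \<open>\<Delta> c\<close> in the tensor square. In the coassociativity axiom,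
  \<open>d\<close> is any choice of representatives of the values of \<open>\<Delta>\<close>; both sides are the
  representatives of \<open>(\<Delta> \<otimes> id) (\<Delta> c)\<close> and \<open>(id \<otimes> \<Delta>) (\<Delta> c)\<close> obtained from it.
\<close>

locale coalgebra = vector_space s
  for s :: "'k::field \<Rightarrow> 'c::ab_group_add \<Rightarrow> 'c" +
  fixes C :: "'c set"
    and \<Delta> :: "'c \<Rightarrow> ('c \<times> 'c \<Rightarrow>\<^sub>0 'k) set"
    and \<epsilon> :: "'c \<Rightarrow> 'k"
  assumes subspace_C: "module.subspace s C"
    and comult_mem: "c \<in> C \<Longrightarrow> \<Delta> c \<in> tensor2 s C"
    and comult_add:
      "a \<in> C \<Longrightarrow> b \<in> C \<Longrightarrow> x \<in> \<Delta> a \<Longrightarrow> y \<in> \<Delta> b \<Longrightarrow> x + y \<in> \<Delta> (a + b)"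
    and comult_scale: "c \<in> C \<Longrightarrow> x \<in> \<Delta> c \<Longrightarrow> fs_scale k x \<in> \<Delta> (s k c)"
    and counit_add: "a \<in> C \<Longrightarrow> b \<in> C \<Longrightarrow> \<epsilon> (a + b) = \<epsilon> a + \<epsilon> b"
    and counit_scale: "c \<in> C \<Longrightarrow> \<epsilon> (s k c) = k * \<epsilon> c"
    and coassoc: "c \<in> C \<Longrightarrow> x \<in> \<Delta> c \<Longrightarrow> (\<And>a. a \<in> C \<Longrightarrow> d a \<in> \<Delta> a) \<Longrightarrow>
      (lin_ext fs_scale (\<lambda>(a, b). lin_ext fs_scale (\<lambda>(a1, a2). gen (a1, a2, b)) (d a)) x,
       lin_ext fs_scale (\<lambda>(a, b). lin_ext fs_scale (\<lambda>(b1, b2). gen (a, b1, b2)) (d b)) x)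
      \<in> tensor3_eq s C"
    and counit_left: "c \<in> C \<Longrightarrow> x \<in> \<Delta> c \<Longrightarrow> lin_ext s (\<lambda>(a, b). s (\<epsilon> a) b) x = c"
    and counit_right: "c \<in> C \<Longrightarrow> x \<in> \<Delta> c \<Longrightarrow> lin_ext s (\<lambda>(a, b). s (\<epsilon> b) a) x = c"

text \<open>An isomorphism of coalgebras from \<open>(C, \<Delta>, \<epsilon>)\<close> to \<open>(C', \<Delta>', \<epsilon>')\<close>; the last conjunct is
  \<open>(\<phi> \<otimes> \<phi>) (\<Delta> c) = \<Delta>' (\<phi> c)\<close>.\<close>

definition coalgebra_iso ::
    "('k::field \<Rightarrow> 'c::ab_group_add \<Rightarrow> 'c) \<Rightarrow> 'c set \<Rightarrow> ('c \<Rightarrow> ('c \<times> 'c \<Rightarrow>\<^sub>0 'k) set) \<Rightarrow> ('c \<Rightarrow> 'k)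
   \<Rightarrow> ('k \<Rightarrow> 'd::ab_group_add \<Rightarrow> 'd) \<Rightarrow> 'd set \<Rightarrow> ('d \<Rightarrow> ('d \<times> 'd \<Rightarrow>\<^sub>0 'k) set) \<Rightarrow> ('d \<Rightarrow> 'k)
   \<Rightarrow> ('c \<Rightarrow> 'd) \<Rightarrow> bool" where
  "coalgebra_iso s C \<Delta> \<epsilon> s' C' \<Delta>' \<epsilon>' \<phi> \<longleftrightarrow>
     bij_betw \<phi> C C'
   \<and> (\<forall>a\<in>C. \<forall>b\<in>C. \<phi> (a + b) = \<phi> a + \<phi> b)
   \<and> (\<forall>k. \<forall>a\<in>C. \<phi> (s k a) = s' k (\<phi> a))
   \<and> (\<forall>a\<in>C. \<epsilon>' (\<phi> a) = \<epsilon> a)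
   \<and> (\<forall>c\<in>C. \<forall>x\<in>\<Delta> c. lin_ext fs_scale (\<lambda>(a, b). gen (\<phi> a, \<phi> b)) x \<in> \<Delta>' (\<phi> c))"

section \<open>Hopf algebras and their duals\<close>

locale hopf_algebra = coalgebra s "UNIV :: 'h::ring_1 set" \<Delta> \<epsilon>
  for s :: "'k::field \<Rightarrow> 'h::ring_1 \<Rightarrow> 'h"
    and \<Delta> :: "'h \<Rightarrow> ('h \<times> 'h \<Rightarrow>\<^sub>0 'k) set"
    and \<epsilon> :: "'h \<Rightarrow> 'k" +
  fixes S :: "'h \<Rightarrow> 'h"
  assumes scale_mult_left: "s k a * b = s k (a * b)"
    and scale_mult_right: "a * s k b = s k (a * b)"
    and counit_one: "\<epsilon> 1 = 1"
    and counit_mult: "\<epsilon> (a * b) = \<epsilon> a * \<epsilon> b"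
    and comult_one: "gen (1, 1) \<in> \<Delta> 1"
    and comult_mult: "x \<in> \<Delta> a \<Longrightarrow> y \<in> \<Delta> b \<Longrightarrow>
      lin_ext fs_scale (\<lambda>(a1, a2). lin_ext fs_scale (\<lambda>(b1, b2). gen (a1 * b1, a2 * b2)) y) x
      \<in> \<Delta> (a * b)"
    and antipode_linear: "Vector_Spaces.linear s s S"
    and antipode_left: "x \<in> \<Delta> a \<Longrightarrow> lin_ext s (\<lambda>(a1, a2). S a1 * a2) x = s (\<epsilon> a) 1"
    and antipode_right: "x \<in> \<Delta> a \<Longrightarrow> lin_ext s (\<lambda>(a1, a2). a1 * S a2) x = s (\<epsilon> a) 1"

definition dual :: "('k::field \<Rightarrow> 'h::ab_group_add \<Rightarrow> 'h) \<Rightarrow> ('h \<Rightarrow> 'k) set" where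
  "dual s = {f. Vector_Spaces.linear s (*) f}"

definition conv ::
    "('h \<Rightarrow> ('h \<times> 'h \<Rightarrow>\<^sub>0 'k) set) \<Rightarrow> ('h \<Rightarrow> 'k) \<Rightarrow> ('h \<Rightarrow> 'k) \<Rightarrow> ('h \<Rightarrow> 'k::field)" where
  "conv \<Delta> f g = (\<lambda>h. tensor2_lift (*) (\<lambda>(a, b). f a * g b) (\<Delta> h))"

definition left_integral ::
    "('k::field \<Rightarrow> 'h::ring_1 \<Rightarrow> 'h) \<Rightarrow> ('h \<Rightarrow> ('h \<times> 'h \<Rightarrow>\<^sub>0 'k) set) \<Rightarrow> ('h \<Rightarrow> 'k) \<Rightarrow> bool" where
  "left_integral s \<Delta> t \<longleftrightarrow> t \<in> dual s \<and> (\<forall>f\<in>dual s. conv \<Delta> f t = fun_scale (f 1) t)"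

definition has_nonzero_integrals ::
    "('k::field \<Rightarrow> 'h::ring_1 \<Rightarrow> 'h) \<Rightarrow> ('h \<Rightarrow> ('h \<times> 'h \<Rightarrow>\<^sub>0 'k) set) \<Rightarrow> bool" where
  "has_nonzero_integrals s \<Delta> \<longleftrightarrow> (\<exists>t. left_integral s \<Delta> t \<and> t \<noteq> 0)"

definition rat_dual ::
    "('k::field \<Rightarrow> 'h::ab_group_add \<Rightarrow> 'h) \<Rightarrow> ('h \<Rightarrow> ('h \<times> 'h \<Rightarrow>\<^sub>0 'k) set) \<Rightarrow> ('h \<Rightarrow> 'k) set" where
  "rat_dual s \<Delta> = {m \<in> dual s. \<exists>(n::nat) \<mu> c. (\<forall>i<n. \<mu> i \<in> dual s) \<and>
     (\<forall>f\<in>dual s. conv \<Delta> f m = (\<Sum>i<n. fun_scale (f (c i)) (\<mu> i)))}"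

section \<open>The finite dual of a not necessarily unital algebra\<close>

text \<open>
  The algebra is a subspace \<open>A\<close> with multiplication \<open>m\<close>. An element of the dual of \<open>A\<close> is
  a function that is linear on \<open>A\<close> and, for uniqueness of representation, zero outside \<open>A\<close>.
\<close>

definition dual_on ::
    "('k::field \<Rightarrow> 'a::ab_group_add \<Rightarrow> 'a) \<Rightarrow> 'a set \<Rightarrow> ('a \<Rightarrow> 'k) set" where
  "dual_on s A = {f. (\<forall>a\<in>A. \<forall>b\<in>A. f (a + b) = f a + f b)
     \<and> (\<forall>k. \<forall>a\<in>A. f (s k a) = k * f a) \<and> (\<forall>a. a \<notin> A \<longrightarrow> f a = 0)}"

definition two_sided_ideal ::
    "('k::field \<Rightarrow> 'a::ab_group_add \<Rightarrow> 'a) \<Rightarrow> 'a set \<Rightarrow> ('a \<Rightarrow> 'a \<Rightarrow> 'a) \<Rightarrow> 'a set \<Rightarrow> bool" where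
  "two_sided_ideal s A m I \<longleftrightarrow> module.subspace s I \<and> I \<subseteq> A
     \<and> (\<forall>a\<in>A. \<forall>x\<in>I. m a x \<in> I \<and> m x a \<in> I)"

text \<open>The quotient \<open>A / I\<close> is spanned by the cosets of finitely many elements.\<close>

definition finite_codim ::
    "('k::field \<Rightarrow> 'a::ab_group_add \<Rightarrow> 'a) \<Rightarrow> 'a set \<Rightarrow> 'a set \<Rightarrow> bool" where
  "finite_codim s A I \<longleftrightarrow> (\<exists>B. finite B \<and> B \<subseteq> A \<and> A \<subseteq> module.span s (I \<union> B))"

definition finite_dual ::
    "('k::field \<Rightarrow> 'a::ab_group_add \<Rightarrow> 'a) \<Rightarrow> 'a set \<Rightarrow> ('a \<Rightarrow> 'a \<Rightarrow> 'a) \<Rightarrow> ('a \<Rightarrow> 'k) set" where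
  "finite_dual s A m = {f \<in> dual_on s A.
     \<exists>I. two_sided_ideal s A m I \<and> finite_codim s A I \<and> (\<forall>x\<in>I. f x = 0)}"

text \<open>All formal sums \<open>\<Sum>\<^sub>j g\<^sub>j \<otimes> h\<^sub>j\<close> over the finite dual with \<open>f (a b) = \<Sum>\<^sub>j g\<^sub>j a * h\<^sub>j b\<close>;
  these form a single class in the tensor square of the finite dual.\<close>

definition finite_dual_comult ::
    "('k::field \<Rightarrow> 'a::ab_group_add \<Rightarrow> 'a) \<Rightarrow> 'a set \<Rightarrow> ('a \<Rightarrow> 'a \<Rightarrow> 'a)
       \<Rightarrow> ('a \<Rightarrow> 'k) \<Rightarrow> (('a \<Rightarrow> 'k) \<times> ('a \<Rightarrow> 'k) \<Rightarrow>\<^sub>0 'k) set" where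
  "finite_dual_comult s A m f = {x \<in> formal (finite_dual s A m \<times> finite_dual s A m).
     \<forall>a\<in>A. \<forall>b\<in>A. f (m a b) = lin_ext (*) (\<lambda>(g, h). g a * h b) x}"

end

theory Submission
  imports Defs
begin

text \<open>
  Write \<open>A\<close> for the rational part of the dual of \<open>H\<close>. The isomorphism is evaluation: an element
  \<open>h\<close> of \<open>H\<close> goes to the functional \<open>a \<mapsto> a h\<close> on \<open>A\<close> (\<open>ev\<close>). It respects comultiplication because
  the product of \<open>A\<close> is convolution, so what has to be seen is that evaluation is a bijection onto
  the finite dual, and this comes from one nonzero left integral \<open>t\<close>.

  \<^item> The functionals \<open>t (x \<cdot>)\<close> are left rational and the functionals \<open>t (h S(\<cdot>))\<close> are right rational.
    Both follow from \<open>\<Sum> u\<^sub>1 t(u\<^sub>2) = t(u) 1\<close>, applied to \<open>u = x h\<close> and to \<open>u = h S(x)\<close>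
    (\<open>integral_shift_left\<close>, \<open>integral_shift_right\<close>).
  \<^item> Each of the two families separates the points of \<open>H\<close> (\<open>integral_left_separates\<close>,
    \<open>integral_right_separates\<close>). The common kernel \<open>K\<close> of a family is stable under one half of the
    comultiplication; contracting the coproduct of \<open>x \<in> K\<close> with the antipode and applying \<open>t\<close> gives
    \<open>\<epsilon>(x) t = 0\<close>, and a subcomodule on which \<open>\<epsilon>\<close> vanishes is zero.
  \<^item> A separating space of functionals takes any prescribed linear values on a finite set
    (\<open>interpolation\<close>). Rationality of \<open>m\<close> says that \<open>f m\<close> depends only on the values of \<open>f\<close> on a
    finite set, so finitely many elements of \<open>A\<close> have a common left unit in \<open>A\<close>: take an element
    that agrees with \<open>\<epsilon>\<close> on a suitable finite set (\<open>left_rat_local_units\<close>). Choosing the unit among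
    right rational functionals instead shows that left rational functionals are right rational
    (\<open>left_rat_imp_right_rat\<close>).

  Injectivity of evaluation is the first separation property. For surjectivity, let \<open>F\<close> vanish on an
  ideal \<open>I\<close> of finite codimension, and let \<open>e\<close> be a left unit for finitely many elements that span
  \<open>A\<close> modulo \<open>I\<close>. Then \<open>F(a) = F(e a)\<close> for all \<open>a\<close>, and since \<open>e\<close> is right rational, \<open>e a\<close> depends
  only on the values of \<open>a\<close> on a finite set. Hence \<open>F\<close> is a combination of evaluations at the points
  of that set, that is, evaluation at one element of \<open>H\<close> (\<open>finite_dual_eq_range\<close>).

  The finite dual is a space of functions on \<open>A\<close>. A tensor over a space of functions is zero as soon
  as all its evaluations are zero (\<open>tensor2_zero\<close>, \<open>tensor3_zero\<close>), so the coalgebra axioms of the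
  finite dual reduce to identities between values, such as associativity of convolution
  (\<open>coalgebra_finite_dual\<close>).
\<close>

section \<open>Formal sums and spaces of functions\<close>

lemma lin_ext_lin_ext:
  fixes G :: "'b \<Rightarrow> 'v::ab_group_add" and s :: "'k::field \<Rightarrow> 'v \<Rightarrow> 'v"
  assumes s: "vector_space s"
  shows "lin_ext s G (lin_ext fs_scale F x) = lin_ext s (\<lambda>a. lin_ext s G (F a)) x"
proof -
  interpret L: Vector_Spaces.linear fs_scale s "lin_ext s G" by (rule linear_lin_ext[OF s])
  show ?thesis
    unfolding lin_ext_def[of fs_scale] by (simp add: L.sum lin_ext_scale[OF s]) (simp add: lin_ext_def)
qed

lemma lin_ext_tensor3_cong:
  assumes s: "vector_space s"
    and add: "\<And>a b u v. G (a + b, u, v) = G (a, u, v) + G (b, u, v)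
          \<and> G (u, a + b, v) = G (u, a, v) + G (u, b, v) \<and> G (u, v, a + b) = G (u, v, a) + G (u, v, b)"
    and scale: "\<And>k a u v. G (t k a, u, v) = s k (G (a, u, v))
          \<and> G (u, t k a, v) = s k (G (u, a, v)) \<and> G (u, v, t k a) = s k (G (u, v, a))"
    and xy: "(x, y) \<in> tensor3_eq t C"
  shows "lin_ext s G x = lin_ext s G y"
proof -
  interpret L: Vector_Spaces.linear fs_scale s "lin_ext s G" by (rule linear_lin_ext[OF s])
  have "x - y \<in> module.span fs_scale (tensor3_rel t C)"
    using xy by (simp add: tensor3_eq_def)
  then have "lin_ext s G (x - y) = 0"
  proof (rule L.eq_0_on_span[rotated])
    show "lin_ext s G z = 0" if "z \<in> tensor3_rel t C" for z
      using that add scale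
      by (auto simp: tensor3_rel_def slot_rel_def L.diff lin_ext_scale[OF s] lin_ext_gen[OF s])
  qed
  then show ?thesis by (simp add: L.diff)
qed

interpretation fun_space: vector_space "fun_scale :: 'k::field \<Rightarrow> ('a \<Rightarrow> 'k) \<Rightarrow> 'a \<Rightarrow> 'k"
  by (rule vector_space_fun_scale)

lemma sum_fun_apply: "(\<Sum>i\<in>I. f i) x = (\<Sum>i\<in>I. f i x)"
  by (induction I rule: infinite_finite_induct) auto

text \<open>
  The functionals on \<open>A\<close> that vanish on the common kernel of finitely many evaluations are the
  combinations of these evaluations. In the induction, an \<open>a0\<close> that is killed by the old evaluations
  but not by the new one determines the coefficient of the new one.
\<close>

lemma functional_eq_sum_evaluations:
  fixes A :: "('x \<Rightarrow> 'k::field) set"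
  assumes A: "fun_space.subspace A" and "finite C"
    and "\<And>a b. a \<in> A \<Longrightarrow> b \<in> A \<Longrightarrow> F (a + b) = F a + F b"
    and "\<And>k a. a \<in> A \<Longrightarrow> F (fun_scale k a) = k * F a"
    and "\<And>a. a \<in> A \<Longrightarrow> (\<And>c. c \<in> C \<Longrightarrow> a c = 0) \<Longrightarrow> F a = 0"
  shows "\<exists>k. \<forall>a\<in>A. F a = (\<Sum>c\<in>C. k c * a c)"
  using assms(2-)
proof (induction C arbitrary: F)
  case empty
  then show ?case by simp
next
  case (insert c C)
  show ?case
  proof (cases "\<exists>a0\<in>A. (\<forall>d\<in>C. a0 d = 0) \<and> a0 c \<noteq> 0")
    case False
    then have "\<exists>k. \<forall>a\<in>A. F a = (\<Sum>c\<in>C. k c * a c)"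
      by (intro insert.IH insert.prems) auto
    then obtain k where k: "\<And>a. a \<in> A \<Longrightarrow> F a = (\<Sum>c\<in>C. k c * a c)" by blast
    have "(\<Sum>d\<in>insert c C. (k(c := 0)) d * a d) = (\<Sum>d\<in>C. k d * a d)" for a
      using insert.hyps by (auto simp: sum.insert intro!: sum.cong)
    then show ?thesis using k by metis
  next
    case True
    then obtain a0 where a0: "a0 \<in> A" "\<And>d. d \<in> C \<Longrightarrow> a0 d = 0" "a0 c \<noteq> 0" by blast
    define r where "r = F a0 / a0 c"
    have "\<exists>k. \<forall>a\<in>A. F a - a c * r = (\<Sum>c\<in>C. k c * a c)"
    proof (rule insert.IH)
      show "F (a + b) - (a + b) c * r = F a - a c * r + (F b - b c * r)" if "a \<in> A" "b \<in> A" for a b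
        using that by (subst insert.prems(1)) (auto simp: algebra_simps)
      show "F (fun_scale k a) - fun_scale k a c * r = k * (F a - a c * r)" if "a \<in> A" for k a
        using that insert.prems by (simp add: algebra_simps fun_scale_def)
      show "F a - a c * r = 0" if a: "a \<in> A" "\<And>c. c \<in> C \<Longrightarrow> a c = 0" for a
      proof -
        define b where "b = a + fun_scale (- (a c / a0 c)) a0"
        have sa: "fun_scale (- (a c / a0 c)) a0 \<in> A" using A a0 fun_space.subspace_scale by blast
        have "b \<in> A" unfolding b_def using A a(1) sa fun_space.subspace_add by blast
        moreover have "b d = 0" if "d \<in> insert c C" for d
          using that a(2) a0 by (auto simp: b_def fun_scale_def)
        ultimately have "F b = 0" by (rule insert.prems(3))
        moreover have "F b = F a - a c / a0 c * F a0"
          unfolding b_def by (subst insert.prems(1)[OF a(1) sa], subst insert.prems(2)[OF a0(1)]) simp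
        ultimately show ?thesis by (simp add: r_def)
      qed
    qed
    then obtain k where k: "\<And>a. a \<in> A \<Longrightarrow> F a = a c * r + (\<Sum>c\<in>C. k c * a c)"
      by (metis diff_eq_eq add.commute)
    have "(\<Sum>d\<in>insert c C. (k(c := r)) d * a d) = a c * r + (\<Sum>d\<in>C. k d * a d)" for a
      using insert.hyps by (auto simp: sum.insert intro!: sum.cong)
    then show ?thesis using k by metis
  qed
qed

text \<open>
  Each further point lowers the dimension of the space of functions that vanish by at most one: one
  function \<open>a0\<close> that does not vanish there makes up for it.
\<close>

lemma finite_codim_vanishing:
  fixes A :: "('x \<Rightarrow> 'k::field) set"
  assumes A: "fun_space.subspace A" and "finite C"
  shows "finite_codim fun_scale A {a \<in> A. \<forall>c\<in>C. a c = 0}"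
  using assms(2)
proof (induction C)
  case empty
  then show ?case by (auto simp: finite_codim_def intro!: exI[of _ "{}"] fun_space.span_base)
next
  case (insert c C)
  then obtain B where B: "finite B" "B \<subseteq> A" "A \<subseteq> fun_space.span ({a \<in> A. \<forall>c\<in>C. a c = 0} \<union> B)"
    by (auto simp: finite_codim_def)
  let ?V = "{a \<in> A. \<forall>d\<in>insert c C. a d = 0}"
  show ?case
  proof (cases "\<exists>a0\<in>A. (\<forall>d\<in>C. a0 d = 0) \<and> a0 c \<noteq> 0")
    case False
    then have "?V = {a \<in> A. \<forall>c\<in>C. a c = 0}" by auto
    then show ?thesis using B unfolding finite_codim_def by auto
  next
    case True
    then obtain a0 where a0: "a0 \<in> A" "\<And>d. d \<in> C \<Longrightarrow> a0 d = 0" "a0 c \<noteq> 0" by blast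
    let ?W = "fun_space.span (?V \<union> insert a0 B)"
    have "a \<in> ?W" if a: "a \<in> A" "\<And>c. c \<in> C \<Longrightarrow> a c = 0" for a
    proof -
      let ?r = "fun_scale (a c / a0 c) a0"
      have "a - ?r \<in> A" using A a a0 by (intro fun_space.subspace_diff fun_space.subspace_scale) auto
      then have "a - ?r \<in> ?W"
        using a a0 by (intro fun_space.span_base) (auto simp: fun_scale_def)
      moreover have "?r \<in> ?W" by (intro fun_space.span_scale fun_space.span_base) auto
      ultimately show ?thesis using fun_space.span_add by fastforce
    qed
    then have "{a \<in> A. \<forall>c\<in>C. a c = 0} \<union> B \<subseteq> ?W" by (auto intro: fun_space.span_base)
    then have "A \<subseteq> ?W" using B(3) fun_space.span_minimal[OF _ fun_space.subspace_span] by blast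
    then show ?thesis
      unfolding finite_codim_def using B(1,2) a0(1) by (intro exI[of _ "insert a0 B"]) auto
  qed
qed

lemma finite_codim_mono:
  assumes "finite_codim fun_scale A I" "I \<subseteq> J"
  shows "finite_codim fun_scale A J"
proof -
  obtain B where "finite B" "B \<subseteq> A" "A \<subseteq> fun_space.span (I \<union> B)"
    using assms(1) unfolding finite_codim_def by (elim exE conjE)
  moreover have "fun_space.span (I \<union> B) \<subseteq> fun_space.span (J \<union> B)"
    using assms(2) by (intro fun_space.span_mono) auto
  ultimately show ?thesis unfolding finite_codim_def by blast
qed

section \<open>Sweedler sums\<close>

context hopf_algebra
begin

definition rep :: "'h \<Rightarrow> ('h \<times> 'h \<Rightarrow>\<^sub>0 'k)" where
  "rep h = (SOME x. x \<in> \<Delta> h)"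

text \<open>
  The Sweedler sum \<open>\<Sum> F h\<^sub>1 h\<^sub>2\<close>. The coefficient of a pair is absorbed into its first entry, which
  keeps the scalar multiplication of the target out of the notation; for bilinear \<open>F\<close> this is the
  usual sum.
\<close>

definition sw :: "'h \<Rightarrow> ('h \<Rightarrow> 'h \<Rightarrow> 'v::ab_group_add) \<Rightarrow> 'v" where
  "sw h F = (\<Sum>p\<in>Poly_Mapping.keys (rep h). F (s (Poly_Mapping.lookup (rep h) p) (fst p)) (snd p))"

lemma rep_mem: "rep h \<in> \<Delta> h"
proof -
  have "\<Delta> h \<in> tensor2 s UNIV" by (simp add: comult_mem)
  then have "\<Delta> h \<noteq> {}"
    unfolding tensor2_def using in_quotient_imp_non_empty[OF equiv_tensor2_eq] by blast
  then show ?thesis unfolding rep_def by (metis ex_in_conv someI_ex)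
qed

abbreviation lin :: "('k \<Rightarrow> 'v::ab_group_add \<Rightarrow> 'v) \<Rightarrow> ('h \<Rightarrow> 'v) \<Rightarrow> bool" where
  "lin s' \<equiv> Vector_Spaces.linear s s'"

lemma linD:
  assumes "lin s' f"
  shows "f (a + b) = f a + f b" "f (s k a) = s' k (f a)" "f 0 = 0" "vector_space s'"
    "f (sum g I) = (\<Sum>i\<in>I. f (g i))"
proof -
  interpret L: Vector_Spaces.linear s s' f by fact
  show "f (a + b) = f a + f b" "f (s k a) = s' k (f a)" "f 0 = 0" "vector_space s'"
    "f (sum g I) = (\<Sum>i\<in>I. f (g i))"
    by (simp_all add: L.add L.scale L.sum) unfold_locales
qed

lemma linI:
  assumes "vector_space s'" "\<And>a b. f (a + b) = f a + f b" "\<And>k a. f (s k a) = s' k (f a)"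
  shows "lin s' f"
  using assms vector_space_axioms by (simp add: Vector_Spaces.linear_iff)

text \<open>
  Bilinear maps do not see the choice of the representative of the coproduct.
\<close>

lemma lin_sw_ext:
  assumes 1: "\<And>b. lin s' (\<lambda>a. F a b)" and 2: "\<And>a. lin s' (F a)" and x: "x \<in> \<Delta> h"
  shows "lin_ext s' (\<lambda>(a, b). F a b) x = sw h F"
proof -
  have "lin_ext s' (\<lambda>(a, b). F a b) x = lin_ext s' (\<lambda>(a, b). F a b) (rep h)"
    by (rule lin_ext_tensor2_cong[where C = UNIV and t = s and X = "\<Delta> h"])
       (use 1 2 x rep_mem comult_mem in \<open>auto simp: linD[OF 1] linD[OF 2]\<close>)
  also have "\<dots> = sw h F"
    unfolding lin_ext_def sw_def by (rule sum.cong) (auto simp: linD[OF 1])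
  finally show ?thesis .
qed

lemma sw_swap: "sw h (\<lambda>a b. sw g (\<lambda>c d. F a b c d)) = sw g (\<lambda>c d. sw h (\<lambda>a b. F a b c d))"
  unfolding sw_def by (rule sum.swap)

lemma sw_lin: "lin s' f \<Longrightarrow> f (sw h F) = sw h (\<lambda>a b. f (F a b))"
  by (simp add: sw_def linD)

text \<open>
  Multilinearity of the expressions under Sweedler sums is proved by peeling off one operation at a
  time; the rules below are collected as \<open>lin_intros\<close>.
\<close>

lemma lin_id: "lin s (\<lambda>x. x)" by (rule linI) (auto simp: vector_space_axioms)
lemma lin_S: "lin s g \<Longrightarrow> lin s (\<lambda>x. S (g x))"
  by (rule linI) (simp_all add: linD linD[OF antipode_linear] vector_space_axioms)
lemma lin_multl: "lin s g \<Longrightarrow> lin s (\<lambda>x. c * g x)"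
  by (rule linI) (auto simp: linD scale_mult_right algebra_simps vector_space_axioms)
lemma lin_multr: "lin s g \<Longrightarrow> lin s (\<lambda>x. g x * c)"
  by (rule linI) (auto simp: linD scale_mult_left algebra_simps vector_space_axioms)
lemma lin_scale1: "lin (*) g \<Longrightarrow> lin s (\<lambda>x. s (g x) c)"
  by (rule linI) (auto simp: linD scale_left_distrib vector_space_axioms)
lemma lin_scale2: "lin s g \<Longrightarrow> lin s (\<lambda>x. s c (g x))"
  by (rule linI) (auto simp: linD scale_right_distrib vector_space_axioms scale_left_commute)
lemma lin_fieldl: "lin (*) g \<Longrightarrow> lin (*) (\<lambda>x. c * g x)"
  by (rule linI) (auto simp: linD algebra_simps vector_space_field)
lemma lin_fieldr: "lin (*) g \<Longrightarrow> lin (*) (\<lambda>x. g x * c)"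
  by (rule linI) (auto simp: linD algebra_simps vector_space_field)
lemma lin_\<epsilon>: "lin s g \<Longrightarrow> lin (*) (\<lambda>x. \<epsilon> (g x))"
  by (rule linI) (auto simp: linD counit_add counit_scale vector_space_field)
lemma lin_comp: "lin s' f \<Longrightarrow> lin s g \<Longrightarrow> lin s' (\<lambda>x. f (g x))"
  by (rule linI) (auto simp: linD)

lemma lin_sw2:
  assumes "\<And>a b. lin s' (\<lambda>x. F x a b)"
  shows "lin s' (\<lambda>x. sw h (\<lambda>a b. F x a b))"
proof -
  interpret V: vector_space s' using linD(4)[OF assms] .
  show ?thesis
    by (rule linI) (auto simp: linD[OF assms] sw_def sum.distrib V.scale_sum_right V.vector_space_axioms)
qed

lemma lin_sw1:
  assumes g: "lin s g" and F: "\<And>b. lin s' (\<lambda>a. F a b)" "\<And>a. lin s' (F a)"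
  shows "lin s' (\<lambda>x. sw (g x) F)"
proof (rule linI)
  note E = lin_sw_ext[OF F]
  note vs = linD(4)[OF F(2)]
  show "vector_space s'" by (rule vs)
  show "sw (g (a + b)) F = sw (g a) F + sw (g b) F" for a b
    using E[OF comult_add[OF _ _ rep_mem rep_mem, of "g a" "g b"]]
    by (simp add: lin_ext_add[OF vs] E[OF rep_mem] linD[OF g])
  show "sw (g (s k a)) F = s' k (sw (g a) F)" for k a
    using E[OF comult_scale[OF _ rep_mem, of "g a" k]]
    by (simp add: lin_ext_scale[OF vs] E[OF rep_mem] linD[OF g])
qed

lemmas lin_intros = lin_id lin_S lin_multl lin_multr lin_scale1 lin_scale2 lin_fieldl lin_fieldr
  lin_\<epsilon> lin_sw1 lin_sw2

text \<open>
  The counit and antipode laws carry an arbitrary linear \<open>f\<close> around both sides so that they can be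
  applied inside larger expressions.
\<close>

lemma sw_counit1:
  assumes "lin s' f" shows "sw h (\<lambda>a b. f (s (\<epsilon> a) b)) = f h"
proof -
  have "sw h (\<lambda>a b. s (\<epsilon> a) b) = h"
    using counit_left[OF UNIV_I rep_mem]
    by (subst lin_sw_ext[symmetric, OF _ _ rep_mem]) (auto intro!: lin_intros)
  then show ?thesis using sw_lin[OF assms, of h "\<lambda>a b. s (\<epsilon> a) b"] by simp
qed

lemma sw_counit2:
  assumes "lin s' f" shows "sw h (\<lambda>a b. f (s (\<epsilon> b) a)) = f h"
proof -
  have "sw h (\<lambda>a b. s (\<epsilon> b) a) = h"
    using counit_right[OF UNIV_I rep_mem]
    by (subst lin_sw_ext[symmetric, OF _ _ rep_mem]) (auto intro!: lin_intros)
  then show ?thesis using sw_lin[OF assms, of h "\<lambda>a b. s (\<epsilon> b) a"] by simp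
qed

lemma sw_antipode1:
  assumes "lin s' f" shows "sw h (\<lambda>a b. f (S a * b)) = f (s (\<epsilon> h) 1)"
proof -
  have "sw h (\<lambda>a b. S a * b) = s (\<epsilon> h) 1"
    using antipode_left[OF rep_mem]
    by (subst lin_sw_ext[symmetric, OF _ _ rep_mem]) (auto intro!: lin_intros)
  then show ?thesis using sw_lin[OF assms, of h "\<lambda>a b. S a * b"] by simp
qed

lemma sw_antipode2:
  assumes "lin s' f" shows "sw h (\<lambda>a b. f (a * S b)) = f (s (\<epsilon> h) 1)"
proof -
  have "sw h (\<lambda>a b. a * S b) = s (\<epsilon> h) 1"
    using antipode_right[OF rep_mem]
    by (subst lin_sw_ext[symmetric, OF _ _ rep_mem]) (auto intro!: lin_intros)
  then show ?thesis using sw_lin[OF assms, of h "\<lambda>a b. a * S b"] by simp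
qed

lemma sw_one:
  assumes F: "\<And>b. lin s' (\<lambda>a. F a b)" "\<And>a. lin s' (F a)"
  shows "sw 1 F = F 1 1"
  using lin_sw_ext[OF F comult_one] by (simp add: lin_ext_gen[OF linD(4)[OF F(2)]])

lemma sw_mult:
  assumes F: "\<And>b. lin s' (\<lambda>a. F a b)" "\<And>a. lin s' (F a)"
  shows "sw (g * h) F = sw g (\<lambda>a b. sw h (\<lambda>c d. F (a * c) (b * d)))"
proof -
  note vs = linD(4)[OF F(2)]
  have L: "lin s' (\<lambda>x. F (a * x) b)" "lin s' (\<lambda>x. F a (b * x))"
     "lin s' (\<lambda>x. F (x * a) b)" "lin s' (\<lambda>x. F a (x * b))" for a b
    using lin_comp[OF F(1) lin_multl[OF lin_id]] lin_comp[OF F(2) lin_multl[OF lin_id]]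
     lin_comp[OF F(1) lin_multr[OF lin_id]] lin_comp[OF F(2) lin_multr[OF lin_id]] by auto
  have "sw (g * h) F = lin_ext s' (\<lambda>(a, b). lin_ext s' (\<lambda>(c, d). F (a * c) (b * d)) (rep h)) (rep g)"
    by (subst lin_sw_ext[OF F comult_mult[OF rep_mem rep_mem], symmetric])
       (simp add: lin_ext_lin_ext[OF vs] case_prod_unfold lin_ext_gen[OF vs])
  also have "\<dots> = lin_ext s' (\<lambda>(a, b). sw h (\<lambda>c d. F (a * c) (b * d))) (rep g)"
    by (simp add: lin_sw_ext[OF L(1,2) rep_mem])
  also have "\<dots> = sw g (\<lambda>a b. sw h (\<lambda>c d. F (a * c) (b * d)))"
    by (rule lin_sw_ext[OF lin_sw2[OF L(3)] lin_sw2[OF L(4)] rep_mem])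
  finally show ?thesis .
qed

lemma sw_coassoc:
  assumes G: "\<And>b c. lin s' (\<lambda>a. G a b c)" "\<And>a c. lin s' (\<lambda>b. G a b c)" "\<And>a b. lin s' (G a b)"
  shows "sw h (\<lambda>y c. sw y (\<lambda>a b. G a b c)) = sw h (\<lambda>a y. sw y (\<lambda>b c. G a b c))"
proof -
  note vs = linD(4)[OF G(3)]
  let ?G = "\<lambda>(a, b, c). G a b c"
  have "lin_ext s' ?G (lin_ext fs_scale (\<lambda>(a, b). lin_ext fs_scale (\<lambda>(a1, a2). gen (a1, a2, b)) (rep a)) (rep h))
     = lin_ext s' ?G (lin_ext fs_scale (\<lambda>(a, b). lin_ext fs_scale (\<lambda>(b1, b2). gen (a, b1, b2)) (rep b)) (rep h))"
    by (rule lin_ext_tensor3_cong[OF vs _ _ coassoc[OF UNIV_I rep_mem rep_mem]])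
       (auto simp: linD[OF G(1)] linD[OF G(2)] linD[OF G(3)])
  then have "lin_ext s' (\<lambda>(y, c). lin_ext s' (\<lambda>(a, b). G a b c) (rep y)) (rep h)
    = lin_ext s' (\<lambda>(a, y). lin_ext s' (\<lambda>(b, c). G a b c) (rep y)) (rep h)"
    by (simp add: lin_ext_lin_ext[OF vs] case_prod_unfold lin_ext_gen[OF vs])
  then have "lin_ext s' (\<lambda>(y, c). sw y (\<lambda>a b. G a b c)) (rep h)
    = lin_ext s' (\<lambda>(a, y). sw y (\<lambda>b c. G a b c)) (rep h)"
    by (simp add: lin_sw_ext[OF G(1,2) rep_mem] lin_sw_ext[OF G(2,3) rep_mem])
  moreover have "lin_ext s' (\<lambda>(y, c). sw y (\<lambda>a b. G a b c)) (rep h) = sw h (\<lambda>y c. sw y (\<lambda>a b. G a b c))"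
    by (rule lin_sw_ext[OF lin_sw1[OF lin_id G(1,2)] lin_sw2[OF G(3)] rep_mem])
  moreover have "lin_ext s' (\<lambda>(a, y). sw y (\<lambda>b c. G a b c)) (rep h) = sw h (\<lambda>a y. sw y (\<lambda>b c. G a b c))"
    by (rule lin_sw_ext[OF lin_sw2[OF G(1)] lin_sw1[OF lin_id G(2,3)] rep_mem])
  ultimately show ?thesis by simp
qed


section \<open>The antipode reverses coproducts\<close>

lemma counit_antipode: "\<epsilon> (S h) = \<epsilon> h"
proof -
  have "\<epsilon> h = \<epsilon> (s (\<epsilon> h) 1)" by (simp add: counit_scale counit_one)
  also have "\<dots> = sw h (\<lambda>a b. \<epsilon> (S a * b))"
    by (subst sw_antipode1[of "(*)"]) (auto intro!: lin_intros)
  also have "\<dots> = sw h (\<lambda>a b. \<epsilon> (S (s (\<epsilon> b) a)))"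
    by (simp add: counit_mult linD[OF antipode_linear] counit_scale mult.commute)
  also have "\<dots> = \<epsilon> (S h)"
    by (rule sw_counit2[where s' = "(*)"]) (intro lin_intros)
  finally show ?thesis by simp
qed

text \<open>
  The coproduct of \<open>S h\<close> is \<open>\<Sum> S h\<^sub>2 \<otimes> S h\<^sub>1\<close>: as maps from \<open>H\<close> to \<open>H \<otimes> H\<close>, both sides are
  convolution inverse to \<open>\<Delta>\<close>. Accordingly the proof computes
  \<open>\<Sum> \<Delta>(S h\<^sub>1) \<Delta>(h\<^sub>2) (S h\<^sub>4 \<otimes> S h\<^sub>3)\<close>
  in two ways, contracting the first two factors or the last two.
\<close>

lemma sw_antipode:
  assumes F: "\<And>b. lin s' (\<lambda>a. F a b)" "\<And>a. lin s' (F a)"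
  shows "sw (S h) F = sw h (\<lambda>a b. F (S b) (S a))"
proof -
  note lins = lin_intros lin_comp[OF F(1)] lin_comp[OF F(2)]
  interpret V: vector_space s' by (rule linD(4)[OF F(2)])
  define G where "G a b c = sw (S a) (\<lambda>u1 u2. sw b (\<lambda>b1 b2. sw c (\<lambda>c1 c2.
      F (u1 * (b1 * S c2)) (u2 * (b2 * S c1)))))" for a b c
  define H where "H v c = sw v (\<lambda>v1 v2. sw c (\<lambda>c1 c2. F (v1 * S c2) (v2 * S c1)))" for v c
  have linH: "lin s' (\<lambda>v. H v c)" for c
    unfolding H_def by (intro lins)
  \<comment> \<open>The two ways of bracketing the threefold product.\<close>
  have "sw h (\<lambda>y c. sw y (\<lambda>a b. G a b c)) = sw h (\<lambda>a y. sw y (\<lambda>b c. G a b c))"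
    by (rule sw_coassoc[where s' = s']; unfold G_def; intro lins)
  moreover have "sw h (\<lambda>y c. sw y (\<lambda>a b. G a b c)) = sw h (\<lambda>a b. F (S b) (S a))"
  proof -
    have "G a b c = H (S a * b) c" for a b c
      unfolding G_def H_def
      by (subst sw_mult[where s' = s']; (intro lins)?) (simp add: mult.assoc)
    then have "sw y (\<lambda>a b. G a b c) = sw (s (\<epsilon> y) c) (\<lambda>c1 c2. F (S c2) (S c1))" for y c
      using sw_antipode1[OF linH, of y c] linD(2)[OF linH, of "\<epsilon> y" 1 c]
        linD(2)[of s' "\<lambda>z. sw z (\<lambda>c1 c2. F (S c2) (S c1))" "\<epsilon> y" c]
        sw_one[of s' "\<lambda>v1 v2. sw c (\<lambda>c1 c2. F (v1 * S c2) (v2 * S c1))"]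
      by (simp add: H_def lins)
    then show ?thesis
      by (simp add: sw_counit1[of s' "\<lambda>z. sw z (\<lambda>c1 c2. F (S c2) (S c1))"] lins)
  qed
  moreover have "sw h (\<lambda>a y. sw y (\<lambda>b c. G a b c)) = sw (S h) F"
  proof -
    \<comment> \<open>The product \<open>\<Delta>(y\<^sub>1) (S y\<^sub>3 \<otimes> S y\<^sub>2)\<close> is \<open>\<epsilon>(y) (1 \<otimes> 1)\<close>.\<close>
    have *: "sw y (\<lambda>b c. sw b (\<lambda>b1 b2. sw c (\<lambda>c1 c2. K (b1 * S c2) (b2 * S c1)))) = s' (\<epsilon> y) (K 1 1)"
      if K: "\<And>b. lin s' (\<lambda>a. K a b)" "\<And>a. lin s' (K a)" for y K
    proof -
      note lins = lin_intros lin_comp[OF K(1)] lin_comp[OF K(2)]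
      have "sw y (\<lambda>b c. sw b (\<lambda>b1 b2. sw c (\<lambda>c1 c2. K (b1 * S c2) (b2 * S c1))))
        = sw y (\<lambda>b1 z. sw z (\<lambda>b2 c. sw c (\<lambda>c1 c2. K (b1 * S c2) (b2 * S c1))))"
        by (rule sw_coassoc[where s' = s']; intro lins)
      also have "\<dots> = sw y (\<lambda>b1 z. sw z (\<lambda>w c2. sw w (\<lambda>b2 c1. K (b1 * S c2) (b2 * S c1))))"
        by (subst sw_coassoc[where s' = s']; (intro lins)?; simp)
      also have "\<dots> = sw y (\<lambda>b1 z. sw z (\<lambda>w c2. K (b1 * S (s (\<epsilon> w) c2)) 1))"
        by (simp add: sw_antipode2[OF K(2)] linD[OF K(2)] linD[OF K(1)] scale_mult_right
            linD[OF antipode_linear])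
      also have "\<dots> = sw y (\<lambda>b1 z. K (b1 * S z) 1)"
        by (subst sw_counit1[where s' = s']; (intro lins)?; simp)
      also have "\<dots> = s' (\<epsilon> y) (K 1 1)"
        by (simp add: sw_antipode2[OF K(1)] linD[OF K(1)])
      finally show ?thesis .
    qed
    have "sw y (\<lambda>b c. G a b c) = sw (S (s (\<epsilon> y) a)) F" for a y
    proof -
      have "sw y (\<lambda>b c. G a b c) = sw (S a) (\<lambda>u1 u2. sw y (\<lambda>b c. sw b (\<lambda>b1 b2. sw c (\<lambda>c1 c2.
          F (u1 * (b1 * S c2)) (u2 * (b2 * S c1))))))"
        unfolding G_def by (rule sw_swap)
      also have "\<dots> = sw (S a) (\<lambda>u1 u2. s' (\<epsilon> y) (F (u1 * 1) (u2 * 1)))"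
      proof -
        have "sw y (\<lambda>b c. sw b (\<lambda>b1 b2. sw c (\<lambda>c1 c2.
            F (u1 * (b1 * S c2)) (u2 * (b2 * S c1))))) = s' (\<epsilon> y) (F (u1 * 1) (u2 * 1))" for u1 u2
          using *[of "\<lambda>p q. F (u1 * p) (u2 * q)" y] by (simp add: lins)
        then show ?thesis by simp
      qed
      also have "\<dots> = s' (\<epsilon> y) (sw (S a) F)"
        by (simp add: sw_def V.scale_sum_right)
      also have "\<dots> = sw (S (s (\<epsilon> y) a)) F"
        using linD(2)[of s' "\<lambda>z. sw (S z) F" "\<epsilon> y" a] by (simp add: lins F)
      finally show ?thesis .
    qed
    then show ?thesis
      by (simp add: sw_counit2[of s' "\<lambda>z. sw (S z) F"] lins)
  qed
  ultimately show ?thesis by simp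
qed

section \<open>Linear functionals and convolution\<close>

lemma dual_iff: "f \<in> dual s \<longleftrightarrow> lin (*) f"
  by (simp add: dual_def)

lemma conv_eq_sw: "conv \<Delta> f g h = sw h (\<lambda>a b. f a * g b)" if "lin (*) f"
  by (simp add: conv_def tensor2_lift_def lin_ext_def sw_def rep_def linD[OF that] case_prod_unfold
      mult.assoc)

lemma lin_coord:
  assumes B: "independent B" "span B = UNIV"
  shows "lin (*) (\<lambda>x. representation B x b)"
  using B by (intro linI) (auto simp: vector_space_field representation_add representation_scale)

lemma dual_separates:
  assumes "\<And>f. lin (*) f \<Longrightarrow> f x = 0" shows "x = 0"
proof -
  let ?B = "extend_basis {}"
  have B: "independent ?B" "span ?B = UNIV"
    using independent_extend_basis[OF independent_empty] span_extend_basis[OF independent_empty] by auto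
  have "representation ?B x b = 0" for b
    by (rule assms[OF lin_coord[OF B]])
  then show ?thesis
    using sum_nonzero_representation_eq[OF B(1), of x] B(2) by simp
qed

lemma dual_separates_eq:
  assumes "\<And>f. lin (*) f \<Longrightarrow> f x = f y" shows "x = y"
  using dual_separates[of "x - y"] assms
  by (metis diff_add_cancel linD(1) add_cancel_right_left eq_iff_diff_eq_0)

text \<open>
  If \<open>\<Sum> u\<^sub>i \<otimes> v\<^sub>i\<close> is killed by every \<open>\<beta> g\<close> on its left factor, then also by functionals that depend
  on the right factor: after expanding the \<open>v\<^sub>i\<close> in a basis, each basis vector \<open>e\<close> contributes only
  the functional \<open>\<beta> (L e)\<close>. This is how an antipode is inserted between the two halves of a coproduct.
\<close>

lemma twist_vanishing_tensor:
  assumes \<beta>: "\<And>a. lin (*) (\<lambda>g. \<beta> g a)" and L: "lin s L" and I: "finite I"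
    and zero: "\<And>g. (\<Sum>i\<in>I. s (\<beta> g (u i)) (v i)) = 0"
  shows "(\<Sum>i\<in>I. \<beta> (L (v i)) (u i)) = 0"
proof -
  let ?B = "extend_basis {}"
  have B: "independent ?B" "span ?B = UNIV"
    using independent_extend_basis[OF independent_empty] span_extend_basis[OF independent_empty] by auto
  define E where "E = (\<Union>i\<in>I. {e. representation ?B (v i) e \<noteq> 0})"
  have E: "finite E" using I by (auto simp: E_def finite_representation)
  have v: "v i = (\<Sum>e\<in>E. s (representation ?B (v i) e) e)" if "i \<in> I" for i
  proof -
    have "v i = (\<Sum>e | representation ?B (v i) e \<noteq> 0. s (representation ?B (v i) e) e)"
      using sum_nonzero_representation_eq[OF B(1), of "v i"] B(2) by simp
    also have "\<dots> = (\<Sum>e\<in>E. s (representation ?B (v i) e) e)"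
      by (rule sum.mono_neutral_left) (use that E in \<open>auto simp: E_def\<close>)
    finally show ?thesis .
  qed
  have "(\<Sum>i\<in>I. \<beta> (L (v i)) (u i)) = (\<Sum>i\<in>I. \<beta> (L (\<Sum>e\<in>E. s (representation ?B (v i) e) e)) (u i))"
    using v by simp
  also have "\<dots> = (\<Sum>i\<in>I. \<Sum>e\<in>E. representation ?B (v i) e * \<beta> (L e) (u i))"
    by (simp add: linD[OF L] linD[OF \<beta>])
  also have "\<dots> = (\<Sum>e\<in>E. \<Sum>i\<in>I. representation ?B (v i) e * \<beta> (L e) (u i))"
    by (rule sum.swap)
  also have "\<dots> = (\<Sum>e\<in>E. representation ?B (\<Sum>i\<in>I. s (\<beta> (L e) (u i)) (v i)) e)"
    by (simp add: linD[OF lin_coord[OF B]] mult.commute)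
  also have "\<dots> = 0" by (simp add: zero linD[OF lin_coord[OF B]])
  finally show ?thesis .
qed


lemma lin_conv: "lin (*) f \<Longrightarrow> lin (*) g \<Longrightarrow> lin (*) (conv \<Delta> f g)"
  by (subst ext[OF conv_eq_sw]) (auto intro!: lin_intros)

lemma conv_assoc:
  assumes "lin (*) f" "lin (*) g" "lin (*) k"
  shows "conv \<Delta> (conv \<Delta> f g) k = conv \<Delta> f (conv \<Delta> g k)"
proof
  fix h
  note lins = lin_intros lin_comp[OF assms(1)] lin_comp[OF assms(2)] lin_comp[OF assms(3)]
  have "conv \<Delta> (conv \<Delta> f g) k h = sw h (\<lambda>y c. sw y (\<lambda>a b. f a * g b * k c))"
    using assms by (simp add: conv_eq_sw lin_conv) (simp add: sw_def sum_distrib_right)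
  also have "\<dots> = sw h (\<lambda>a y. sw y (\<lambda>b c. f a * g b * k c))"
    by (rule sw_coassoc[where s' = "(*)"]; intro lins)
  also have "\<dots> = conv \<Delta> f (conv \<Delta> g k) h"
    using assms by (simp add: conv_eq_sw lin_conv) (simp add: sw_def sum_distrib_left mult.assoc)
  finally show "conv \<Delta> (conv \<Delta> f g) k h = conv \<Delta> f (conv \<Delta> g k) h" .
qed

lemma lin_counit: "lin (*) \<epsilon>"
  using lin_\<epsilon>[OF lin_id] .

lemma conv_counit_left: "lin (*) f \<Longrightarrow> conv \<Delta> \<epsilon> f = f"
  using sw_counit1[of "(*)" f] by (auto simp: conv_eq_sw lin_counit linD(2))

lemma conv_counit_right: "lin (*) f \<Longrightarrow> conv \<Delta> f \<epsilon> = f"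
  using sw_counit2[of "(*)" f] by (auto simp: conv_eq_sw linD(2) mult.commute)

lemma lin_fun_add: "lin (*) f \<Longrightarrow> lin (*) g \<Longrightarrow> lin (*) (f + g)"
  by (rule linI) (auto simp: linD vector_space_field algebra_simps)
lemma lin_fun_diff: "lin (*) f \<Longrightarrow> lin (*) g \<Longrightarrow> lin (*) (f - g)"
  by (rule linI) (auto simp: linD vector_space_field algebra_simps)
lemma lin_fun_scale: "lin (*) f \<Longrightarrow> lin (*) (fun_scale k f)"
  by (rule linI) (auto simp: linD vector_space_field algebra_simps fun_scale_def)
lemma lin_fun_zero: "lin (*) 0"
  by (rule linI) (auto simp: vector_space_field)
lemma lin_fun_sum: "(\<And>i. i \<in> I \<Longrightarrow> lin (*) (f i)) \<Longrightarrow> lin (*) (sum f I)"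
  by (induction I rule: infinite_finite_induct) (auto intro: lin_fun_add lin_fun_zero)

lemma conv_add_left: "lin (*) f \<Longrightarrow> lin (*) g \<Longrightarrow> conv \<Delta> (f + g) m = conv \<Delta> f m + conv \<Delta> g m"
  by (rule ext) (simp add: conv_eq_sw lin_fun_add, simp add: sw_def sum.distrib algebra_simps)
lemma conv_add_right: "lin (*) m \<Longrightarrow> conv \<Delta> m (f + g) = conv \<Delta> m f + conv \<Delta> m g"
  by (rule ext) (simp add: conv_eq_sw, simp add: sw_def sum.distrib algebra_simps)
lemma conv_scale_left: "lin (*) f \<Longrightarrow> conv \<Delta> (fun_scale k f) m = fun_scale k (conv \<Delta> f m)"
  by (rule ext) (simp add: conv_eq_sw lin_fun_scale, simp add: fun_scale_def conv_eq_sw sw_def sum_distrib_left mult.assoc)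
lemma conv_scale_right: "lin (*) m \<Longrightarrow> conv \<Delta> m (fun_scale k f) = fun_scale k (conv \<Delta> m f)"
  by (rule ext) (simp add: conv_eq_sw fun_scale_def, simp add: conv_eq_sw sw_def sum_distrib_left mult.left_commute)
lemma conv_diff_left: "lin (*) f \<Longrightarrow> lin (*) g \<Longrightarrow> conv \<Delta> (f - g) m = conv \<Delta> f m - conv \<Delta> g m"
  by (rule ext) (simp add: conv_eq_sw lin_fun_diff, simp add: sw_def sum_subtractf algebra_simps)
lemma conv_zero_right: "lin (*) m \<Longrightarrow> conv \<Delta> m 0 = 0"
  by (rule ext) (simp add: conv_eq_sw, simp add: sw_def)
lemma conv_zero_left: "conv \<Delta> 0 m = 0"
  by (rule ext) (simp add: conv_eq_sw lin_fun_zero, simp add: sw_def)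
lemma conv_sum_left:
  "(\<And>i. i \<in> I \<Longrightarrow> lin (*) (f i)) \<Longrightarrow> conv \<Delta> (sum f I) m = (\<Sum>i\<in>I. conv \<Delta> (f i) m)"
  by (induction I rule: infinite_finite_induct)
     (simp_all add: conv_zero_left conv_add_left lin_fun_sum)

section \<open>Rational functionals\<close>

text \<open>
  For fixed \<open>m\<close> the map \<open>f \<mapsto> f m\<close> has the form \<open>f \<mapsto> \<Sum> f(c\<^sub>i) m\<^sub>i\<close> exactly if \<open>f m\<close> depends only on
  the values of \<open>f\<close> on a finite set. In this form rationality is visibly stable under sums and under
  multiplication from both sides.
\<close>

definition left_rat :: "('h \<Rightarrow> 'k) \<Rightarrow> bool" where
  "left_rat m \<longleftrightarrow> lin (*) m \<and> (\<exists>C. finite C \<and> (\<forall>f. lin (*) f \<longrightarrow> (\<forall>c\<in>C. f c = 0) \<longrightarrow> conv \<Delta> f m = 0))"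

definition right_rat :: "('h \<Rightarrow> 'k) \<Rightarrow> bool" where
  "right_rat m \<longleftrightarrow> lin (*) m \<and> (\<exists>C. finite C \<and> (\<forall>f. lin (*) f \<longrightarrow> (\<forall>c\<in>C. f c = 0) \<longrightarrow> conv \<Delta> m f = 0))"

text \<open>
  The finite set on which \<open>f\<close> matters is replaced by a basis \<open>B\<close> of its span. With the coordinate
  functionals \<open>p\<^sub>b\<close> of a basis of \<open>H\<close> that extends \<open>B\<close>, the functional \<open>f - \<Sum> f(b) p\<^sub>b\<close> vanishes
  on \<open>B\<close>, so \<open>f m = \<Sum> f(b) (p\<^sub>b m)\<close>.
\<close>

lemma rat_dual_eq: "rat_dual s \<Delta> = {m. left_rat m}"
proof (intro set_eqI iffI; simp)
  fix m assume m: "m \<in> rat_dual s \<Delta>"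
  then obtain n c and \<mu> :: "nat \<Rightarrow> 'h \<Rightarrow> 'k"
    where *: "\<forall>f\<in>dual s. conv \<Delta> f m = (\<Sum>i<n. fun_scale (f (c i)) (\<mu> i))"
    by (auto simp: rat_dual_def)
  show "left_rat m"
    unfolding left_rat_def
  proof (intro conjI exI[of _ "c ` {..<n}"] allI impI)
    show "lin (*) m" using m by (simp add: rat_dual_def dual_iff)
    show "conv \<Delta> f m = 0" if "lin (*) f" "\<forall>x\<in>c ` {..<n}. f x = 0" for f
      using that * by (simp add: dual_iff)
  qed simp
next
  fix m assume "left_rat m"
  then obtain C where m: "lin (*) m" and C: "finite C"
      "\<And>f. lin (*) f \<Longrightarrow> (\<And>c. c \<in> C \<Longrightarrow> f c = 0) \<Longrightarrow> conv \<Delta> f m = 0"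
    by (auto simp: left_rat_def)
  obtain B where B: "B \<subseteq> C" "independent B" "C \<subseteq> span B"
    using maximal_independent_subset by metis
  then have finB: "finite B" using C(1) finite_subset by blast
  let ?E = "extend_basis B"
  define p where "p b x = representation ?E x b" for b x
  have E: "independent ?E" "span ?E = UNIV" "B \<subseteq> ?E"
    using B(2) by (simp_all add: independent_extend_basis span_extend_basis extend_basis_superset)
  have p: "lin (*) (p b)" for b unfolding p_def[abs_def] by (rule lin_coord[OF E(1,2)])
  have pB: "p b x = (if x = b then 1 else 0)" if "x \<in> B" for b x
    using that E(3) by (auto simp: p_def representation_basis[OF E(1)])
  obtain c where c: "bij_betw c {..<card B} B"
    using ex_bij_betw_nat_finite[OF finB] by (auto simp: atLeast0LessThan)
  have "conv \<Delta> f m = (\<Sum>i<card B. fun_scale (f (c i)) (conv \<Delta> (p (c i)) m))" if f: "lin (*) f" for f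
  proof -
    define g where "g = (\<Sum>b\<in>B. fun_scale (f b) (p b))"
    have lg: "lin (*) g" unfolding g_def by (intro lin_fun_sum lin_fun_scale p)
    have "(f - g) x = 0" if "x \<in> B" for x
      using that finB by (simp add: g_def sum_fun_apply fun_scale_def pB sum.delta if_distrib cong: if_cong)
    then have "conv \<Delta> (f - g) m = 0"
      using B(3) module_hom.eq_0_on_span[OF Vector_Spaces.linear.axioms(3)[OF lin_fun_diff[OF f lg]], of B]
      by (intro C(2) lin_fun_diff[OF f lg]) (auto simp: subset_iff)
    then have "conv \<Delta> f m = conv \<Delta> g m" by (simp add: conv_diff_left f lg)
    also have "\<dots> = (\<Sum>b\<in>B. fun_scale (f b) (conv \<Delta> (p b) m))"
      by (simp add: g_def conv_sum_left conv_scale_left lin_fun_scale p)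
    also have "\<dots> = (\<Sum>i<card B. fun_scale (f (c i)) (conv \<Delta> (p (c i)) m))"
      by (rule sum.reindex_bij_betw[OF c, symmetric])
    finally show ?thesis .
  qed
  then show "m \<in> rat_dual s \<Delta>"
    unfolding rat_dual_def using m p
    by (auto simp: dual_iff intro!: exI[of _ "card B"] exI[of _ "\<lambda>i. conv \<Delta> (p (c i)) m"]
        exI[of _ c] lin_conv)
qed


lemma conv_eq_apply_right: "lin (*) f \<Longrightarrow> lin (*) g \<Longrightarrow> conv \<Delta> f g h = g (sw h (\<lambda>a b. s (f a) b))"
  by (simp add: conv_eq_sw sw_lin[of _ g] linD)

lemma conv_eq_apply_left: "lin (*) f \<Longrightarrow> lin (*) g \<Longrightarrow> conv \<Delta> f g h = f (sw h (\<lambda>a b. s (g b) a))"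
  by (simp add: conv_eq_sw sw_lin[of _ f] linD mult.commute)

lemma left_rat_lin: "left_rat m \<Longrightarrow> lin (*) m" by (simp add: left_rat_def)
lemma right_rat_lin: "right_rat m \<Longrightarrow> lin (*) m" by (simp add: right_rat_def)

lemma left_ratI:
  assumes "lin (*) m" "finite C" "\<And>f. lin (*) f \<Longrightarrow> (\<And>c. c \<in> C \<Longrightarrow> f c = 0) \<Longrightarrow> conv \<Delta> f m = 0"
  shows "left_rat m"
  using assms unfolding left_rat_def by blast

lemma left_ratE:
  assumes "left_rat m"
  obtains C where "finite C" "\<And>f. lin (*) f \<Longrightarrow> (\<And>c. c \<in> C \<Longrightarrow> f c = 0) \<Longrightarrow> conv \<Delta> f m = 0"
proof -
  obtain C where "finite C" and C: "\<forall>f. lin (*) f \<longrightarrow> (\<forall>c\<in>C. f c = 0) \<longrightarrow> conv \<Delta> f m = 0"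
    using assms unfolding left_rat_def by (elim conjE exE)
  show thesis
    by (rule that[OF \<open>finite C\<close>]) (rule C[rule_format])
qed

lemma right_ratI:
  assumes "lin (*) m" "finite C" "\<And>f. lin (*) f \<Longrightarrow> (\<And>c. c \<in> C \<Longrightarrow> f c = 0) \<Longrightarrow> conv \<Delta> m f = 0"
  shows "right_rat m"
  using assms unfolding right_rat_def by blast

lemma right_ratE:
  assumes "right_rat m"
  obtains C where "finite C" "\<And>f. lin (*) f \<Longrightarrow> (\<And>c. c \<in> C \<Longrightarrow> f c = 0) \<Longrightarrow> conv \<Delta> m f = 0"
proof -
  obtain C where "finite C" and C: "\<forall>f. lin (*) f \<longrightarrow> (\<forall>c\<in>C. f c = 0) \<longrightarrow> conv \<Delta> m f = 0"
    using assms unfolding right_rat_def by (elim conjE exE)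
  show thesis
    by (rule that[OF \<open>finite C\<close>]) (rule C[rule_format])
qed

lemma subspace_left_rat: "fun_space.subspace {m. left_rat m}"
proof (rule fun_space.subspaceI; clarsimp)
  show "left_rat 0"
    by (rule left_ratI[of _ "{}"]) (auto simp: lin_fun_zero conv_zero_right)
next
  fix m n assume mn: "left_rat m" "left_rat n"
  obtain C where C: "finite C" "\<And>f. lin (*) f \<Longrightarrow> (\<And>c. c \<in> C \<Longrightarrow> f c = 0) \<Longrightarrow> conv \<Delta> f m = 0"
    using left_ratE[OF mn(1)] by blast
  obtain D where D: "finite D" "\<And>f. lin (*) f \<Longrightarrow> (\<And>c. c \<in> D \<Longrightarrow> f c = 0) \<Longrightarrow> conv \<Delta> f n = 0"
    using left_ratE[OF mn(2)] by blast
  from mn C D show "left_rat (m + n)"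
    by (intro left_ratI[of _ "C \<union> D"]) (auto simp: lin_fun_add left_rat_lin conv_add_right)
next
  fix k m assume m: "left_rat m"
  obtain C where "finite C" "\<And>f. lin (*) f \<Longrightarrow> (\<And>c. c \<in> C \<Longrightarrow> f c = 0) \<Longrightarrow> conv \<Delta> f m = 0"
    using left_ratE[OF m] by blast
  with m show "left_rat (fun_scale k m)"
    by (intro left_ratI[of _ C]) (auto simp: lin_fun_scale left_rat_lin conv_scale_right)
qed

lemma subspace_right_rat: "fun_space.subspace {m. right_rat m}"
proof (rule fun_space.subspaceI; clarsimp)
  show "right_rat 0"
    by (rule right_ratI[of _ "{}"]) (auto simp: lin_fun_zero conv_zero_left)
next
  fix m n assume mn: "right_rat m" "right_rat n"
  obtain C where C: "finite C" "\<And>f. lin (*) f \<Longrightarrow> (\<And>c. c \<in> C \<Longrightarrow> f c = 0) \<Longrightarrow> conv \<Delta> m f = 0"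
    using right_ratE[OF mn(1)] by blast
  obtain D where D: "finite D" "\<And>f. lin (*) f \<Longrightarrow> (\<And>c. c \<in> D \<Longrightarrow> f c = 0) \<Longrightarrow> conv \<Delta> n f = 0"
    using right_ratE[OF mn(2)] by blast
  from mn C D show "right_rat (m + n)"
    by (intro right_ratI[of _ "C \<union> D"]) (auto simp: lin_fun_add right_rat_lin conv_add_left)
next
  fix k m assume m: "right_rat m"
  obtain C where "finite C" "\<And>f. lin (*) f \<Longrightarrow> (\<And>c. c \<in> C \<Longrightarrow> f c = 0) \<Longrightarrow> conv \<Delta> m f = 0"
    using right_ratE[OF m] by blast
  with m show "right_rat (fun_scale k m)"
    by (intro right_ratI[of _ C]) (auto simp: lin_fun_scale right_rat_lin conv_scale_left)
qed

lemma left_rat_conv_right: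
  assumes m: "left_rat m" and g: "lin (*) g" shows "left_rat (conv \<Delta> m g)"
proof -
  note lm = left_rat_lin[OF m]
  obtain C where C: "finite C" "\<And>f. lin (*) f \<Longrightarrow> (\<And>c. c \<in> C \<Longrightarrow> f c = 0) \<Longrightarrow> conv \<Delta> f m = 0"
    using left_ratE[OF m] by blast
  show ?thesis
    by (rule left_ratI[OF lin_conv[OF lm g] C(1)])
       (simp add: conv_assoc[symmetric] lm g C(2) conv_zero_left)
qed

lemma left_rat_conv_left:
  assumes m: "left_rat m" and g: "lin (*) g" shows "left_rat (conv \<Delta> g m)"
proof -
  note lm = left_rat_lin[OF m]
  obtain C where C: "finite C" "\<And>f. lin (*) f \<Longrightarrow> (\<And>c. c \<in> C \<Longrightarrow> f c = 0) \<Longrightarrow> conv \<Delta> f m = 0"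
    using left_ratE[OF m] by blast
  show ?thesis
    by (rule left_ratI[OF lin_conv[OF g lm], of "(\<lambda>c. sw c (\<lambda>a b. s (g b) a)) ` C"])
       (use C in \<open>auto simp: conv_assoc[symmetric] lm g lin_conv conv_eq_apply_left[of _ g] intro!: C(2)\<close>)
qed

lemma right_rat_conv_right:
  assumes m: "right_rat m" and g: "lin (*) g" shows "right_rat (conv \<Delta> m g)"
proof -
  note lm = right_rat_lin[OF m]
  obtain C where C: "finite C" "\<And>f. lin (*) f \<Longrightarrow> (\<And>c. c \<in> C \<Longrightarrow> f c = 0) \<Longrightarrow> conv \<Delta> m f = 0"
    using right_ratE[OF m] by blast
  show ?thesis
    by (rule right_ratI[OF lin_conv[OF lm g], of "(\<lambda>c. sw c (\<lambda>a b. s (g a) b)) ` C"])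
       (use C in \<open>auto simp: conv_assoc lm g lin_conv conv_eq_apply_right[of g] intro!: C(2)\<close>)
qed

text \<open>
  If no element of \<open>A\<close> vanishes on \<open>C\<close> but not at \<open>c\<close>, then on \<open>A\<close> evaluation at \<open>c\<close> is a combination
  of the evaluations at the points of \<open>C\<close>; as \<open>A\<close> separates points, \<open>c\<close> is the same combination of
  these points, and the values at \<open>c\<close> agree by linearity.
\<close>

lemma interpolation:
  assumes A: "fun_space.subspace A" and A_lin: "\<And>a. a \<in> A \<Longrightarrow> lin (*) a"
    and sep: "\<And>x. (\<And>a. a \<in> A \<Longrightarrow> a x = 0) \<Longrightarrow> x = 0"
    and "finite C" and g: "lin (*) g"
  shows "\<exists>e\<in>A. \<forall>c\<in>C. e c = g c"
  using \<open>finite C\<close>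
proof (induction C)
  case empty
  show ?case using fun_space.subspace_0[OF A] by auto
next
  case (insert c C)
  then obtain e where e: "e \<in> A" "\<And>d. d \<in> C \<Longrightarrow> e d = g d" by blast
  show ?case
  proof (cases "\<exists>a\<in>A. (\<forall>d\<in>C. a d = 0) \<and> a c \<noteq> 0")
    case True
    then obtain a where a: "a \<in> A" "\<And>d. d \<in> C \<Longrightarrow> a d = 0" "a c \<noteq> 0" by blast
    have "e + fun_scale ((g c - e c) / a c) a \<in> A"
      using A e a by (intro fun_space.subspace_add fun_space.subspace_scale)
    moreover have "\<forall>d\<in>insert c C. (e + fun_scale ((g c - e c) / a c) a) d = g d"
      using e a by (auto simp: fun_scale_def)
    ultimately show ?thesis by blast
  next
    case False
    then have "\<exists>k. \<forall>a\<in>A. a c = (\<Sum>d\<in>C. k d * a d)"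
      by (intro functional_eq_sum_evaluations[OF A insert.hyps(1)]) (auto simp: fun_scale_def)
    then obtain k where k: "\<And>a. a \<in> A \<Longrightarrow> a c = (\<Sum>d\<in>C. k d * a d)" by blast
    have "c - (\<Sum>d\<in>C. s (k d) d) = 0"
    proof (rule sep)
      fix a assume a: "a \<in> A"
      interpret L: Vector_Spaces.linear s "(*)" a by (rule A_lin[OF a])
      show "a (c - (\<Sum>d\<in>C. s (k d) d)) = 0"
        using k[OF a] by (simp add: L.diff L.sum L.scale)
    qed
    then have c: "c = (\<Sum>d\<in>C. s (k d) d)" by simp
    have "e c = g c"
      by (subst (1 2) c) (simp add: linD[OF g] linD[OF A_lin[OF e(1)]] e(2))
    then show ?thesis using e by blast
  qed
qed

section \<open>Integrals\<close>

text \<open>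
  The defining property of a left integral, with the arbitrary functional removed.
\<close>

lemma integral_sw:
  assumes "left_integral s \<Delta> t"
  shows "sw h (\<lambda>a b. s (t b) a) = s (t h) 1"
proof (rule dual_separates_eq)
  fix f assume f: "lin (*) f"
  have t: "lin (*) t" "conv \<Delta> f t = fun_scale (f 1) t"
    using assms f by (auto simp: left_integral_def dual_iff)
  show "f (sw h (\<lambda>a b. s (t b) a)) = f (s (t h) 1)"
    using fun_cong[OF t(2), of h] conv_eq_apply_left[OF f t(1), of h]
    by (simp add: fun_scale_def linD[OF f] mult.commute)
qed

lemma integral_lin: "left_integral s \<Delta> t \<Longrightarrow> lin (*) t"
  by (simp add: left_integral_def dual_iff)

text \<open>
  The identity \<open>\<Sum> h\<^sub>1 t(x h\<^sub>2) = \<Sum> S(x\<^sub>1) t(x\<^sub>2 h)\<close>: on the right, \<open>t(x\<^sub>2 h) 1\<close> is the integral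
  sum of \<open>x\<^sub>2 h\<close>, and the antipode cancels the first leg of \<open>x\<close>.
\<close>

lemma integral_shift_left:
  assumes t: "left_integral s \<Delta> t"
  shows "sw h (\<lambda>a b. s (t (x * b)) a) = sw x (\<lambda>a b. s (t (b * h)) (S a))"
proof -
  note lins = lin_intros lin_comp[OF integral_lin[OF t]]
  define N where "N p q = sw h (\<lambda>h1 h2. s (t (q * h2)) (p * h1))" for p q
  have N: "lin s (\<lambda>p. N p q)" "lin s (N p)" for p q
    unfolding N_def by (intro lins)+
  have "sw x (\<lambda>a b. s (t (b * h)) (S a)) = sw x (\<lambda>a b. S a * s (t (b * h)) 1)"
    by (simp add: scale_mult_right)
  also have "\<dots> = sw x (\<lambda>a b. sw b (\<lambda>c d. sw h (\<lambda>h1 h2. S a * s (t (d * h2)) (c * h1))))"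
  proof -
    have "S a * s (t (b * h)) 1 = sw b (\<lambda>c d. sw h (\<lambda>h1 h2. S a * s (t (d * h2)) (c * h1)))" for a b
      unfolding integral_sw[OF t, symmetric]
      by (subst sw_lin[where f = "\<lambda>z. S a * z" and s' = s], intro lins, rule sw_mult[where s' = s]; intro lins)
    then show ?thesis by simp
  qed
  also have "\<dots> = sw x (\<lambda>a b. sw b (\<lambda>c d. N (S a * c) d))"
    by (simp add: N_def scale_mult_right mult.assoc)
  also have "\<dots> = sw x (\<lambda>b d. sw b (\<lambda>a c. N (S a * c) d))"
    by (rule sw_coassoc[where s' = s, symmetric]; intro lins lin_comp[OF N(1)] lin_comp[OF N(2)])
  also have "\<dots> = sw x (\<lambda>b d. N 1 (s (\<epsilon> b) d))"
    by (simp add: sw_antipode1[OF N(1)] linD[OF N(1)] linD[OF N(2)])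
  also have "\<dots> = N 1 x"
    by (rule sw_counit1[OF N(2)])
  finally show ?thesis by (simp add: N_def)
qed

text \<open>
  The identity \<open>\<Sum> t(h S(x\<^sub>1)) x\<^sub>2 = \<Sum> h\<^sub>1 t(h\<^sub>2 S(x))\<close>: on the left, \<open>t(h S(x\<^sub>1)) 1\<close> is the
  integral sum of \<open>h S(x\<^sub>1)\<close>, whose first leg ends in \<open>S(x\<^sub>2)\<close> because \<open>S\<close> reverses coproducts, and
  this cancels against \<open>x\<^sub>3\<close>.
\<close>

lemma integral_shift_right:
  assumes t: "left_integral s \<Delta> t"
  shows "sw x (\<lambda>a b. s (t (h * S a)) b) = sw h (\<lambda>a b. s (t (b * S x)) a)"
proof -
  note lins = lin_intros lin_comp[OF integral_lin[OF t]]
  define N where "N p q = sw h (\<lambda>h1 h2. s (t (h2 * S q)) (h1 * p))" for p q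
  have N: "lin s (\<lambda>p. N p q)" "lin s (N p)" for p q
    unfolding N_def by (intro lins)+
  have "sw x (\<lambda>a b. s (t (h * S a)) b) = sw x (\<lambda>a b. s (t (h * S a)) 1 * b)"
    by (simp add: scale_mult_left)
  also have "\<dots> = sw x (\<lambda>a b. sw a (\<lambda>c d. N (S d * b) c))"
  proof -
    have "s (t (h * S a)) 1 * b = sw a (\<lambda>c d. N (S d * b) c)" for a b
    proof -
      have "s (t (h * S a)) 1 * b = sw (h * S a) (\<lambda>c d. s (t d) c * b)"
        unfolding integral_sw[OF t, symmetric]
        by (rule sw_lin[where f = "\<lambda>z. z * b" and s' = s]) (intro lins)
      also have "\<dots> = sw h (\<lambda>h1 h2. sw (S a) (\<lambda>c d. s (t (h2 * d)) (h1 * c) * b))"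
        by (rule sw_mult[where s' = s]; intro lins)
      also have "\<dots> = sw h (\<lambda>h1 h2. sw a (\<lambda>c d. s (t (h2 * S c)) (h1 * S d) * b))"
        by (subst sw_antipode[where s' = s]; (intro lins)?; simp)
      also have "\<dots> = sw a (\<lambda>c d. N (S d * b) c)"
        by (subst sw_swap) (simp add: N_def scale_mult_left mult.assoc)
      finally show ?thesis .
    qed
    then show ?thesis by simp
  qed
  also have "\<dots> = sw x (\<lambda>c a. sw a (\<lambda>d b. N (S d * b) c))"
    by (rule sw_coassoc[where s' = s]; intro lins lin_comp[OF N(1)] lin_comp[OF N(2)])
  also have "\<dots> = sw x (\<lambda>c a. N 1 (s (\<epsilon> a) c))"
    by (simp add: sw_antipode1[OF N(1)] linD[OF N(1)] linD[OF N(2)])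
  also have "\<dots> = N 1 x"
    by (rule sw_counit2[OF N(2)])
  finally show ?thesis by (simp add: N_def)
qed

text \<open>
  By \<open>integral_shift_left\<close>, convolution with \<open>f\<close> from the left involves only the values of \<open>f\<close> at the
  first legs of the coproduct of \<open>x\<close>, under \<open>S\<close>.
\<close>

lemma left_rat_integral:
  assumes t: "left_integral s \<Delta> t" shows "left_rat (\<lambda>h. t (x * h))"
proof -
  note lins = lin_intros lin_comp[OF integral_lin[OF t]]
  have l: "lin (*) (\<lambda>h. t (x * h))" by (intro lins)
  show ?thesis
  proof (rule left_ratI[OF l])
    let ?c = "\<lambda>p. S (s (Poly_Mapping.lookup (rep x) p) (fst p))"
    show "finite (?c ` Poly_Mapping.keys (rep x))" by simp
    fix f assume f: "lin (*) f" and 0: "\<And>c. c \<in> ?c ` Poly_Mapping.keys (rep x) \<Longrightarrow> f c = 0"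
    show "conv \<Delta> f (\<lambda>h. t (x * h)) = 0"
    proof
      fix h
      have "conv \<Delta> f (\<lambda>h. t (x * h)) h = f (sw x (\<lambda>a b. s (t (b * h)) (S a)))"
        by (simp add: conv_eq_apply_left[OF f l] integral_shift_left[OF t])
      also have "\<dots> = 0"
        by (simp add: sw_def linD[OF f] 0)
      finally show "conv \<Delta> f (\<lambda>h. t (x * h)) h = 0 h" by simp
    qed
  qed
qed

text \<open>
  By \<open>integral_shift_right\<close>, convolution with \<open>f\<close> from the right involves only the values of \<open>f\<close> at the
  first legs of the coproduct of \<open>h\<close>. The antipode in the argument of \<open>t\<close> is what puts these
  functionals on the right rational side.
\<close>

lemma right_rat_integral:
  assumes t: "left_integral s \<Delta> t" shows "right_rat (\<lambda>x. t (h * S x))"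
proof -
  note lins = lin_intros lin_comp[OF integral_lin[OF t]]
  have l: "lin (*) (\<lambda>x. t (h * S x))" by (intro lins)
  show ?thesis
  proof (rule right_ratI[OF l])
    let ?c = "fst :: 'h \<times> 'h \<Rightarrow> 'h"
    show "finite (?c ` Poly_Mapping.keys (rep h))" by simp
    fix f assume f: "lin (*) f" and 0: "\<And>c. c \<in> ?c ` Poly_Mapping.keys (rep h) \<Longrightarrow> f c = 0"
    show "conv \<Delta> (\<lambda>x. t (h * S x)) f = 0"
    proof
      fix x
      have "conv \<Delta> (\<lambda>x. t (h * S x)) f x = f (sw h (\<lambda>a b. s (t (b * S x)) a))"
        by (simp add: conv_eq_apply_right[OF l f] integral_shift_right[OF t])
      also have "\<dots> = 0"
        by (simp add: sw_def linD[OF f] 0)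
      finally show "conv \<Delta> (\<lambda>x. t (h * S x)) f x = 0 x" by simp
    qed
  qed
qed

text \<open>
  Let \<open>K\<close> be the set of all \<open>h\<close> with \<open>t(g h) = 0\<close> for all \<open>g\<close>. For \<open>h \<in> K\<close> the shift identity gives
  \<open>\<Sum> h\<^sub>1 t(g h\<^sub>2) = 0\<close> for all \<open>g\<close>. Taking \<open>y S(h\<^sub>1)\<close> for \<open>g\<close> yields \<open>\<epsilon>(h) t(y) = 0\<close>, so \<open>\<epsilon>\<close>
  vanishes on \<open>K\<close>. The identity also shows \<open>\<Sum> f(h\<^sub>1) h\<^sub>2 \<in> K\<close> for every functional \<open>f\<close>, and \<open>\<epsilon>\<close> of
  this element is \<open>f(h)\<close>.
\<close>

lemma integral_left_separates:
  assumes t: "left_integral s \<Delta> t" "t \<noteq> 0" and x: "\<And>g. t (g * x) = 0"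
  shows "x = 0"
proof -
  note tl = integral_lin[OF t(1)]
  note lins = lin_intros lin_comp[OF tl]
  have \<epsilon>0: "\<epsilon> h = 0" if h: "\<And>g. t (g * h) = 0" for h
  proof -
    obtain y where y: "t y \<noteq> 0" using t(2) by (auto simp: fun_eq_iff)
    have "sw h (\<lambda>a b. s (t (g * b)) a) = 0" for g
      by (simp add: integral_shift_left[OF t(1)] h sw_def linD[OF antipode_linear])
    \<comment> \<open>Here \<open>y S(h\<^sub>1)\<close> takes the place of \<open>g\<close>.\<close>
    then have "sw h (\<lambda>a b. t (y * S a * b)) = 0"
      unfolding sw_def
      by (intro twist_vanishing_tensor[where \<beta> = "\<lambda>g b. t (g * b)" and L = "\<lambda>a. y * S a"])
         (auto intro!: lins)
    moreover have "sw h (\<lambda>a b. t (y * S a * b)) = \<epsilon> h * t y"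
      using sw_antipode1[of "(*)" "\<lambda>z. t (y * z)" h]
      by (simp add: lins mult.assoc scale_mult_right linD[OF tl])
    ultimately show ?thesis using y by simp
  qed
  show ?thesis
  proof (rule dual_separates)
    fix f assume f: "lin (*) f"
    define z where "z = sw x (\<lambda>a b. s (f a) b)"
    have "t (g * z) = 0" for g
    proof -
      have "t (g * z) = f (sw x (\<lambda>a b. s (t (g * b)) a))"
        using sw_lin[of "(*)" "\<lambda>z. t (g * z)" x "\<lambda>a b. s (f a) b"]
        by (simp add: z_def lins sw_lin[OF f] scale_mult_right linD[OF tl] linD[OF f] mult.commute)
      also have "\<dots> = 0"
        by (simp add: integral_shift_left[OF t(1)] x sw_def linD[OF f] linD[OF antipode_linear])
      finally show ?thesis .
    qed
    then have "\<epsilon> z = 0" by (rule \<epsilon>0)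
    moreover have "\<epsilon> z = f x"
      using conv_eq_apply_right[OF f lin_counit, of x] by (simp add: z_def conv_counit_right f)
    ultimately show "f x = 0" by simp
  qed
qed

text \<open>
  The same argument for the set of all \<open>h\<close> with \<open>t(g S(h)) = 0\<close> for all \<open>g\<close>. Here the contraction is
  \<open>\<Sum> S(S(h\<^sub>2)) S(h\<^sub>1) = \<epsilon>(h) 1\<close>, the antipode axiom for \<open>S(h)\<close>.
\<close>

lemma integral_right_separates:
  assumes t: "left_integral s \<Delta> t" "t \<noteq> 0" and x: "\<And>g. t (g * S x) = 0"
  shows "x = 0"
proof -
  note tl = integral_lin[OF t(1)]
  note lins = lin_intros lin_comp[OF tl]
  have \<epsilon>0: "\<epsilon> h = 0" if h: "\<And>g. t (g * S h) = 0" for h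
  proof -
    obtain y where y: "t y \<noteq> 0" using t(2) by (auto simp: fun_eq_iff)
    have "sw h (\<lambda>a b. s (t (g * S a)) b) = 0" for g
      by (simp add: integral_shift_right[OF t(1)] h sw_def)
    \<comment> \<open>Here \<open>y S(S(h\<^sub>2))\<close> takes the place of \<open>g\<close>.\<close>
    then have "sw h (\<lambda>a b. t (y * S (S b) * S a)) = 0"
      unfolding sw_def
      by (intro twist_vanishing_tensor[where \<beta> = "\<lambda>g a. t (g * S a)" and L = "\<lambda>b. y * S (S b)"])
         (auto intro!: lins)
    moreover have "sw h (\<lambda>a b. t (y * S (S b) * S a)) = sw (S h) (\<lambda>a b. t (y * S a * b))"
      by (subst sw_antipode[where s' = "(*)"]; (intro lins)?; simp)
    moreover have "\<dots> = \<epsilon> h * t y"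
      using sw_antipode1[of "(*)" "\<lambda>z. t (y * z)" "S h"]
      by (simp add: lins mult.assoc scale_mult_right linD[OF tl] counit_antipode)
    ultimately show ?thesis using y by simp
  qed
  show ?thesis
  proof (rule dual_separates)
    fix f assume f: "lin (*) f"
    define z where "z = sw x (\<lambda>a b. s (f b) a)"
    have "t (g * S z) = 0" for g
    proof -
      have "t (g * S z) = f (sw x (\<lambda>a b. s (t (g * S a)) b))"
        using sw_lin[of "(*)" "\<lambda>z. t (g * S z)" x "\<lambda>a b. s (f b) a"]
        by (simp add: z_def lins sw_lin[OF f] scale_mult_right linD[OF tl] linD[OF f]
            linD[OF antipode_linear] mult.commute)
      also have "\<dots> = 0"
        by (simp add: integral_shift_right[OF t(1)] x sw_def linD[OF f])
      finally show ?thesis .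
    qed
    then have "\<epsilon> z = 0" by (rule \<epsilon>0)
    moreover have "\<epsilon> z = f x"
      using conv_eq_apply_left[OF lin_counit f, of x] by (simp add: z_def conv_counit_left f)
    ultimately show "f x = 0" by simp
  qed
qed

text \<open>
  Right rational functionals separate points, so one of them, \<open>e\<close>, agrees with \<open>\<epsilon>\<close> on the finite set
  that matters for \<open>m\<close>. Then \<open>m = e m\<close>, a right multiple of a right rational functional.
\<close>

lemma left_rat_imp_right_rat:
  assumes t: "left_integral s \<Delta> t" "t \<noteq> 0" and m: "left_rat m"
  shows "right_rat m"
proof -
  note lm = left_rat_lin[OF m]
  obtain C where C: "finite C" "\<And>f. lin (*) f \<Longrightarrow> (\<And>c. c \<in> C \<Longrightarrow> f c = 0) \<Longrightarrow> conv \<Delta> f m = 0"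
    using left_ratE[OF m] by blast
  have "\<exists>e\<in>{m. right_rat m}. \<forall>c\<in>C. e c = \<epsilon> c"
    using integral_right_separates[OF t] right_rat_integral[OF t(1)]
    by (intro interpolation subspace_right_rat C(1) lin_counit) (auto simp: right_rat_lin)
  then obtain e where e: "right_rat e" "\<And>c. c \<in> C \<Longrightarrow> e c = \<epsilon> c" by blast
  have "conv \<Delta> (e - \<epsilon>) m = 0"
    using e by (intro C(2)) (auto simp: lin_fun_diff right_rat_lin lin_counit)
  then have "conv \<Delta> e m = m"
    by (simp add: conv_diff_left right_rat_lin[OF e(1)] lin_counit conv_counit_left lm)
  then show ?thesis using right_rat_conv_right[OF e(1) lm] by simp
qed

lemma left_rat_interpolation:
  assumes t: "left_integral s \<Delta> t" "t \<noteq> 0" and "finite C" "lin (*) g"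
  shows "\<exists>e. left_rat e \<and> (\<forall>c\<in>C. e c = g c)"
proof -
  have "\<exists>e\<in>{m. left_rat m}. \<forall>c\<in>C. e c = g c"
    using integral_left_separates[OF t] left_rat_integral[OF t(1)] assms(3,4)
    by (intro interpolation subspace_left_rat) (auto simp: left_rat_lin)
  then show ?thesis by blast
qed

lemma left_rat_local_units:
  assumes t: "left_integral s \<Delta> t" "t \<noteq> 0" and B: "finite B" "\<And>b. b \<in> B \<Longrightarrow> left_rat b"
  shows "\<exists>e. left_rat e \<and> (\<forall>b\<in>B. conv \<Delta> e b = b)"
proof -
  have "\<forall>b\<in>B. \<exists>C. finite C \<and> (\<forall>f. lin (*) f \<longrightarrow> (\<forall>c\<in>C. f c = 0) \<longrightarrow> conv \<Delta> f b = 0)"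
    using B(2) by (auto simp: left_rat_def)
  then obtain C where C: "\<And>b. b \<in> B \<Longrightarrow> finite (C b)"
      "\<And>b f. b \<in> B \<Longrightarrow> lin (*) f \<Longrightarrow> (\<And>c. c \<in> C b \<Longrightarrow> f c = 0) \<Longrightarrow> conv \<Delta> f b = 0"
    by metis
  obtain e where e: "left_rat e" "\<And>b c. b \<in> B \<Longrightarrow> c \<in> C b \<Longrightarrow> e c = \<epsilon> c"
    using left_rat_interpolation[OF t, of "\<Union>b\<in>B. C b" \<epsilon>] B(1) C(1) lin_counit by auto
  have "conv \<Delta> e b = b" if b: "b \<in> B" for b
  proof -
    have "conv \<Delta> (e - \<epsilon>) b = 0"
      using e b by (intro C(2)) (auto simp: lin_fun_diff left_rat_lin lin_counit)
    then show ?thesis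
      by (simp add: conv_diff_left left_rat_lin[OF e(1)] lin_counit conv_counit_left left_rat_lin[OF B(2)[OF b]])
  qed
  then show ?thesis using e(1) by blast
qed

end

section \<open>Zero tensors over a space of functions\<close>

interpretation formal_space: vector_space "fs_scale :: 'k::field \<Rightarrow> ('a \<Rightarrow>\<^sub>0 'k) \<Rightarrow> ('a \<Rightarrow>\<^sub>0 'k)"
  by (rule vector_space_fs_scale)

lemma formal_subspace: "formal_space.subspace (formal X)"
  by (rule formal_space.subspaceI)
     (auto simp: formal_def in_keys_iff lookup_add subset_iff, metis add.right_neutral)

lemma gen_in_formal: "gen a \<in> formal X \<longleftrightarrow> a \<in> X"
  by (simp add: formal_def)

lemma lin_ext_in_formal:
  "(\<And>a. a \<in> Poly_Mapping.keys x \<Longrightarrow> F a \<in> formal X) \<Longrightarrow> lin_ext fs_scale F x \<in> formal X"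
  unfolding lin_ext_def by (intro formal_space.subspace_sum formal_space.subspace_scale formal_subspace) auto

lemma lin_ext_diff:
  assumes "vector_space s" shows "lin_ext s F (x - y) = lin_ext s F x - lin_ext s F y"
proof -
  interpret L: Vector_Spaces.linear fs_scale s "lin_ext s F" by (rule linear_lin_ext[OF assms])
  show ?thesis by (rule L.diff)
qed

lemma lin_ext_cong:
  "(\<And>a. a \<in> Poly_Mapping.keys x \<Longrightarrow> F a = G a) \<Longrightarrow> lin_ext s F x = lin_ext s G x"
  by (simp add: lin_ext_def)

lemma lin_ext_gen_id: "lin_ext fs_scale gen x = x"
proof (rule poly_mapping_eqI)
  fix a
  have "Poly_Mapping.lookup (\<Sum>b\<in>I. f b) a = (\<Sum>b\<in>I. Poly_Mapping.lookup (f b) a)"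
    for I and f :: "'a \<Rightarrow> ('a \<Rightarrow>\<^sub>0 'b)"
    by (induction I rule: infinite_finite_induct) (auto simp: lookup_add)
  then show "Poly_Mapping.lookup (lin_ext fs_scale gen x) a = Poly_Mapping.lookup x a"
    by (auto simp: lin_ext_def lookup_single when_def if_distrib sum.delta in_keys_iff cong: if_cong)
qed

text \<open>
  Modulo the relators of a slot, a generator is linear in that slot.
\<close>

lemma gen_slot_sum:
  assumes s: "vector_space s" and C: "module.subspace s C" and R: "slot_rel s C e \<subseteq> R"
    and I: "finite I" "\<And>i. i \<in> I \<Longrightarrow> a i \<in> C"
  shows "gen (e (\<Sum>i\<in>I. s (k i) (a i))) - (\<Sum>i\<in>I. fs_scale (k i) (gen (e (a i)))) \<in> formal_space.span R"
  using I
proof (induction I)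
  case empty
  interpret V: vector_space s by (rule s)
  have "gen (e (s 0 0)) - fs_scale 0 (gen (e 0)) \<in> slot_rel s C e"
    unfolding slot_rel_def using V.subspace_0[OF C] by blast
  then show ?case using R by (auto intro: formal_space.span_base)
next
  case (insert i I)
  interpret V: vector_space s by (rule s)
  let ?x = "s (k i) (a i)" and ?y = "\<Sum>i\<in>I. s (k i) (a i)"
  have "?x \<in> C" "?y \<in> C" using insert.prems by (auto intro!: V.subspace_scale V.subspace_sum C)
  then have "gen (e (?x + ?y)) - gen (e ?x) - gen (e ?y) \<in> slot_rel s C e"
    unfolding slot_rel_def by blast
  moreover have "gen (e ?x) - fs_scale (k i) (gen (e (a i))) \<in> slot_rel s C e"
    unfolding slot_rel_def using insert.prems by blast
  moreover have "gen (e ?y) - (\<Sum>i\<in>I. fs_scale (k i) (gen (e (a i)))) \<in> formal_space.span R"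
    using insert by auto
  ultimately have "(gen (e (?x + ?y)) - gen (e ?x) - gen (e ?y))
      + (gen (e ?x) - fs_scale (k i) (gen (e (a i))))
      + (gen (e ?y) - (\<Sum>i\<in>I. fs_scale (k i) (gen (e (a i))))) \<in> formal_space.span R"
    using R by (intro formal_space.span_add) (auto intro: formal_space.span_base)
  then show ?case using insert.hyps by (simp add: algebra_simps)
qed

text \<open>
  One step of the reduction of a zero test for tensors over function spaces to fewer slots. Expanding
  the first entries in a basis \<open>B\<close> of their span turns \<open>z\<close> into \<open>\<Sum> b \<otimes> w\<^sub>b\<close>. If all evaluations
  of \<open>z\<close> vanish, then independence of \<open>B\<close> shows that all evaluations of every \<open>w\<^sub>b\<close> vanish. The type
  of \<open>Y\<close> is left open so that the remaining part can have one slot or two.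
\<close>

lemma first_slot_zero:
  fixes C :: "('x \<Rightarrow> 'k::field) set" and z :: "('x \<Rightarrow> 'k) \<times> 'y \<Rightarrow>\<^sub>0 'k"
  assumes C: "fun_space.subspace C" and sep: "\<And>f. f \<in> C \<Longrightarrow> (\<And>a. a \<in> A \<Longrightarrow> f a = 0) \<Longrightarrow> f = 0"
    and R: "\<And>y. y \<in> Y \<Longrightarrow> slot_rel fun_scale C (\<lambda>a. (a, y)) \<subseteq> R"
    and z: "z \<in> formal (C \<times> Y)"
    and zero: "\<And>a i. a \<in> A \<Longrightarrow> i \<in> J \<Longrightarrow> lin_ext (*) (\<lambda>(g, y). g a * \<psi> i y) z = 0"
    and rest: "\<And>b w. b \<in> C \<Longrightarrow> w \<in> formal Y \<Longrightarrow> (\<And>i. i \<in> J \<Longrightarrow> lin_ext (*) (\<psi> i) w = 0)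
        \<Longrightarrow> lin_ext fs_scale (\<lambda>y. gen (b, y)) w \<in> formal_space.span R"
  shows "z \<in> formal_space.span R"
proof -
  let ?K = "Poly_Mapping.keys z" and ?z = "Poly_Mapping.lookup z"
  have K: "p \<in> C" "y \<in> Y" if "(p, y) \<in> ?K" for p y
    using z that by (auto simp: formal_def)
  obtain B where B: "B \<subseteq> fst ` ?K" "fun_space.independent B" "fst ` ?K \<subseteq> fun_space.span B"
    by (rule fun_space.maximal_independent_subset)
  have finB: "finite B" using finite_subset[OF B(1)] by simp
  have BC: "B \<subseteq> C" using B(1) K by force
  define r where "r b p = fun_space.representation B p b" for b p
  have r: "(\<Sum>b\<in>B. fun_scale (r b p) b) = p" if "p \<in> fst ` ?K" for p
    using fun_space.sum_representation_eq[OF B(2) _ finB order_refl, of p] that B(3) by (auto simp: r_def)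
  define w where "w b = (\<Sum>x\<in>?K. fs_scale (?z x * r b (fst x)) (gen (snd x)))" for b
  have lw: "lin_ext s' F (w b) = (\<Sum>x\<in>?K. s' (?z x * r b (fst x)) (F (snd x)))"
    if "vector_space s'" for s' F b
  proof -
    interpret L: Vector_Spaces.linear fs_scale s' "lin_ext s' F" by (rule linear_lin_ext[OF that])
    show ?thesis by (simp add: w_def L.sum L.scale lin_ext_gen[OF that])
  qed
  have "lin_ext (*) (\<psi> i) (w b) = 0" if i: "i \<in> J" and b: "b \<in> B" for i b
  proof -
    \<comment> \<open>Contracting the remaining slots of \<open>\<Sum> b \<otimes> w\<^sub>b\<close> with \<open>\<psi> i\<close> leaves an element of \<open>C\<close>.\<close>
    let ?f = "\<Sum>b\<in>B. fun_scale (lin_ext (*) (\<psi> i) (w b)) b"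
    have "?f = 0"
    proof (rule sep)
      show "?f \<in> C" using BC by (intro fun_space.subspace_sum fun_space.subspace_scale C) auto
      fix a assume a: "a \<in> A"
      have "?f a = (\<Sum>b\<in>B. \<Sum>x\<in>?K. ?z x * r b (fst x) * \<psi> i (snd x) * b a)"
        by (simp add: sum_fun_apply fun_scale_def lw[OF vector_space_field] sum_distrib_right)
      also have "\<dots> = (\<Sum>x\<in>?K. \<Sum>b\<in>B. ?z x * r b (fst x) * \<psi> i (snd x) * b a)"
        by (rule sum.swap)
      also have "\<dots> = (\<Sum>x\<in>?K. ?z x * ((\<Sum>b\<in>B. fun_scale (r b (fst x)) b) a * \<psi> i (snd x)))"
        by (simp add: sum_fun_apply fun_scale_def sum_distrib_left sum_distrib_right mult_ac)
      also have "\<dots> = (\<Sum>x\<in>?K. ?z x * (fst x a * \<psi> i (snd x)))"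
        by (intro sum.cong refl) (simp add: r)
      also have "\<dots> = 0"
        using zero[OF a i] by (simp add: lin_ext_def case_prod_unfold)
      finally show "?f a = 0" .
    qed
    then show ?thesis by (rule fun_space.independentD[OF B(2) finB order_refl _ b])
  qed
  moreover have "w b \<in> formal Y" for b
    unfolding w_def using K
    by (intro formal_space.subspace_sum formal_space.subspace_scale formal_subspace) (auto simp: gen_in_formal)
  ultimately have "lin_ext fs_scale (\<lambda>y. gen (b, y)) (w b) \<in> formal_space.span R" if "b \<in> B" for b
    using that BC by (intro rest) auto
  then have "(\<Sum>b\<in>B. lin_ext fs_scale (\<lambda>y. gen (b, y)) (w b)) \<in> formal_space.span R"
    by (rule formal_space.span_sum)
  moreover have "z - (\<Sum>b\<in>B. lin_ext fs_scale (\<lambda>y. gen (b, y)) (w b)) \<in> formal_space.span R"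
  proof -
    have "(\<Sum>b\<in>B. lin_ext fs_scale (\<lambda>y. gen (b, y)) (w b))
       = (\<Sum>x\<in>?K. fs_scale (?z x) (\<Sum>b\<in>B. fs_scale (r b (fst x)) (gen (b, snd x))))"
      by (simp add: lw[OF vector_space_fs_scale] formal_space.scale_sum_right sum.swap[of _ B])
    moreover have "z = (\<Sum>x\<in>?K. fs_scale (?z x) (gen x))"
      using lin_ext_gen_id[of z] by (simp add: lin_ext_def)
    ultimately have "z - (\<Sum>b\<in>B. lin_ext fs_scale (\<lambda>y. gen (b, y)) (w b))
       = (\<Sum>x\<in>?K. fs_scale (?z x) (gen x - (\<Sum>b\<in>B. fs_scale (r b (fst x)) (gen (b, snd x)))))"
      by (simp add: formal_space.scale_right_diff_distrib sum_subtractf)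
    also have "\<dots> \<in> formal_space.span R"
    proof (intro formal_space.span_sum formal_space.span_scale)
      fix x assume x: "x \<in> ?K"
      then have "snd x \<in> Y" using K(2)[of "fst x" "snd x"] by simp
      then have "gen (\<Sum>b\<in>B. fun_scale (r b (fst x)) b, snd x)
          - (\<Sum>b\<in>B. fs_scale (r b (fst x)) (gen (b, snd x))) \<in> formal_space.span R"
        using BC by (intro gen_slot_sum[OF vector_space_fun_scale C R finB]) auto
      then show "gen x - (\<Sum>b\<in>B. fs_scale (r b (fst x)) (gen (b, snd x))) \<in> formal_space.span R"
        using x by (simp add: r)
    qed
    finally show ?thesis .
  qed
  ultimately show ?thesis using formal_space.span_add by fastforce
qed

text \<open>
  The remaining slot after \<open>first_slot_zero\<close> carries a formal sum of functions; when all its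
  evaluations vanish, the corresponding actual sum is zero, and \<open>b \<otimes> 0\<close> is a zero tensor.
\<close>

lemma tensor2_zero:
  fixes C :: "('x \<Rightarrow> 'k::field) set"
  assumes C: "fun_space.subspace C" and sep: "\<And>f. f \<in> C \<Longrightarrow> (\<And>a. a \<in> A \<Longrightarrow> f a = 0) \<Longrightarrow> f = 0"
    and z: "z \<in> formal (C \<times> C)"
    and zero: "\<And>a b. a \<in> A \<Longrightarrow> b \<in> A \<Longrightarrow> lin_ext (*) (\<lambda>(g, h). g a * h b) z = 0"
  shows "z \<in> formal_space.span (tensor2_rel fun_scale C)"
proof (rule first_slot_zero[OF C sep _ z, where J = A and \<psi> = "\<lambda>b h. h b"])
  fix b and w :: "('x \<Rightarrow> 'k) \<Rightarrow>\<^sub>0 'k"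
  assume b: "b \<in> C" and w: "w \<in> formal C" and 0: "\<And>i. i \<in> A \<Longrightarrow> lin_ext (*) (\<lambda>h. h i) w = 0"
  let ?K = "Poly_Mapping.keys w" and ?w = "Poly_Mapping.lookup w"
  let ?R = "tensor2_rel fun_scale C"
  have K: "y \<in> C" if "y \<in> ?K" for y using w that by (auto simp: formal_def)
  have R: "slot_rel fun_scale C (\<lambda>y. (b, y)) \<subseteq> ?R"
    unfolding tensor2_rel_def using b by blast
  have "(\<Sum>y\<in>?K. fun_scale (?w y) y) = 0"
    using 0 K by (intro sep fun_space.subspace_sum fun_space.subspace_scale C)
      (auto simp: sum_fun_apply fun_scale_def lin_ext_def)
  then have "gen (b, 0) - lin_ext fs_scale (\<lambda>y. gen (b, y)) w \<in> formal_space.span ?R"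
    using gen_slot_sum[OF vector_space_fun_scale C R, of ?K "\<lambda>y. y" ?w] K by (simp add: lin_ext_def)
  moreover have "gen (b, 0) \<in> formal_space.span ?R"
    using gen_slot_sum[OF vector_space_fun_scale C R, of "{}"] by simp
  ultimately show "lin_ext fs_scale (\<lambda>y. gen (b, y)) w \<in> formal_space.span ?R"
    using formal_space.span_diff by fastforce
qed (use zero in \<open>auto simp: tensor2_rel_def\<close>)

text \<open>
  After removal of the first slot the remaining \<open>w\<close> is zero in the tensor square, and \<open>b \<otimes> \<cdot>\<close> maps
  the relators of the square to relators of the cube.
\<close>

lemma tensor3_zero:
  fixes C :: "('x \<Rightarrow> 'k::field) set"
  assumes C: "fun_space.subspace C" and sep: "\<And>f. f \<in> C \<Longrightarrow> (\<And>a. a \<in> A \<Longrightarrow> f a = 0) \<Longrightarrow> f = 0"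
    and z: "z \<in> formal (C \<times> C \<times> C)"
    and zero: "\<And>a b c. a \<in> A \<Longrightarrow> b \<in> A \<Longrightarrow> c \<in> A \<Longrightarrow> lin_ext (*) (\<lambda>(f, g, h). f a * (g b * h c)) z = 0"
  shows "z \<in> formal_space.span (tensor3_rel fun_scale C)"
proof (rule first_slot_zero[OF C sep _ z, where J = "A \<times> A" and \<psi> = "\<lambda>(b, c) (g, h). g b * h c"])
  fix b and w :: "('x \<Rightarrow> 'k) \<times> ('x \<Rightarrow> 'k) \<Rightarrow>\<^sub>0 'k"
  assume b: "b \<in> C" and w: "w \<in> formal (C \<times> C)"
    and 0: "\<And>i. i \<in> A \<times> A \<Longrightarrow> lin_ext (*) ((\<lambda>(b, c) (g, h). g b * h c) i) w = 0"
  interpret L: Vector_Spaces.linear fs_scale fs_scale "lin_ext fs_scale (\<lambda>y. gen (b, y))"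
    by (rule linear_lin_ext[OF vector_space_fs_scale])
  have "w \<in> formal_space.span (tensor2_rel fun_scale C)"
  proof (rule tensor2_zero[OF C sep w])
    show "lin_ext (*) (\<lambda>(g, h). g a * h b) w = 0" if "a \<in> A" "b \<in> A" for a b
      using 0[of "(a, b)"] that by simp
  qed
  then have "lin_ext fs_scale (\<lambda>y. gen (b, y)) w
      \<in> formal_space.span (lin_ext fs_scale (\<lambda>y. gen (b, y)) ` tensor2_rel fun_scale C)"
    by (auto simp: L.span_image)
  moreover have "lin_ext fs_scale (\<lambda>y. gen (b, y)) x \<in> tensor3_rel fun_scale C"
    if "x \<in> tensor2_rel fun_scale C" for x
  proof -
    have slot: "lin_ext fs_scale (\<lambda>y. gen (b, y)) x \<in> slot_rel fun_scale C (\<lambda>a. (b, e a))"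
      if "x \<in> slot_rel fun_scale C e" for e
      using that unfolding slot_rel_def
      by (elim UnE CollectE exE conjE)
         (auto simp: L.diff lin_ext_scale[OF vector_space_fs_scale] lin_ext_gen[OF vector_space_fs_scale])
    obtain u where u: "u \<in> C"
      "x \<in> slot_rel fun_scale C (\<lambda>a. (a, u)) \<or> x \<in> slot_rel fun_scale C (\<lambda>a. (u, a))"
      using \<open>x \<in> tensor2_rel fun_scale C\<close> unfolding tensor2_rel_def by blast
    then have "lin_ext fs_scale (\<lambda>y. gen (b, y)) x
        \<in> slot_rel fun_scale C (\<lambda>a. (b, a, u)) \<union> slot_rel fun_scale C (\<lambda>a. (b, u, a))"
      using slot by blast
    then show ?thesis using b u(1) unfolding tensor3_rel_def by blast
  qed
  ultimately show "lin_ext fs_scale (\<lambda>y. gen (b, y)) w \<in> formal_space.span (tensor3_rel fun_scale C)"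
    by (rule subsetD[OF formal_space.span_mono[OF image_subsetI], rotated])
qed (use zero in \<open>auto simp: tensor3_rel_def case_prod_unfold\<close>)

section \<open>The coalgebra structure of a finite dual\<close>

lemma finite_dual_eq_0:
  assumes "f \<in> finite_dual fun_scale A m" "\<And>a. a \<in> A \<Longrightarrow> f a = 0"
  shows "f = 0"
proof
  show "f a = 0 a" for a
    using assms by (cases "a \<in> A") (auto simp: finite_dual_def dual_on_def)
qed

lemma finite_dual_comult_eq:
  fixes A :: "('x \<Rightarrow> 'k::field) set"
  assumes C: "fun_space.subspace (finite_dual fun_scale A m)"
    and xy: "x \<in> finite_dual_comult fun_scale A m F" "y \<in> finite_dual_comult fun_scale A m F"
  shows "(x, y) \<in> tensor2_eq fun_scale (finite_dual fun_scale A m)"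
proof -
  have "x - y \<in> formal_space.span (tensor2_rel fun_scale (finite_dual fun_scale A m))"
  proof (rule tensor2_zero[OF C, where A = A])
    show "f = 0" if "f \<in> finite_dual fun_scale A m" "\<And>a. a \<in> A \<Longrightarrow> f a = 0" for f
      using that by (rule finite_dual_eq_0)
    show "x - y \<in> formal (finite_dual fun_scale A m \<times> finite_dual fun_scale A m)"
      using xy by (intro formal_space.subspace_diff formal_subspace) (auto simp: finite_dual_comult_def)
    show "lin_ext (*) (\<lambda>(g, h). g a * h b) (x - y) = 0" if "a \<in> A" "b \<in> A" for a b
      using xy that by (simp add: lin_ext_diff[OF vector_space_field] finite_dual_comult_def)
  qed
  then show ?thesis using xy by (simp add: tensor2_eq_def finite_dual_comult_def)
qed

lemma lin_ext_mult_right: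
  "lin_ext (*) (\<lambda>x. f x * c) z = lin_ext (*) f z * (c :: 'k::field)"
  by (simp add: lin_ext_def sum_distrib_right mult.assoc)

lemma lin_ext_mult_left:
  "lin_ext (*) (\<lambda>x. c * f x) z = (c :: 'k::field) * lin_ext (*) f z"
  by (simp add: lin_ext_def sum_distrib_left mult.left_commute)

text \<open>
  The values of \<open>\<Delta>'\<close> are single classes by \<open>finite_dual_comult_eq\<close>, so the counit laws carry over from
  one representative to all of them. Coassociativity is an equality of tensors over \<open>D\<close>, hence an
  equality of evaluations: on both sides they are \<open>F (a b c)\<close>.
\<close>

lemma coalgebra_finite_dual:
  fixes A :: "('x \<Rightarrow> 'k::field) set" and m and \<epsilon>'
  defines "D \<equiv> finite_dual fun_scale A m"
    and "\<Delta>' \<equiv> finite_dual_comult fun_scale A m"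
  assumes closed: "\<And>a b. a \<in> A \<Longrightarrow> b \<in> A \<Longrightarrow> m a b \<in> A"
    and assoc: "\<And>a b c. a \<in> A \<Longrightarrow> b \<in> A \<Longrightarrow> c \<in> A \<Longrightarrow> m (m a b) c = m a (m b c)"
    and D: "fun_space.subspace D"
    and ex: "\<And>F. F \<in> D \<Longrightarrow> \<exists>x\<in>\<Delta>' F.
        lin_ext fun_scale (\<lambda>(g, h). fun_scale (\<epsilon>' g) h) x = F \<and>
        lin_ext fun_scale (\<lambda>(g, h). fun_scale (\<epsilon>' h) g) x = F"
    and \<epsilon>_add: "\<And>F G. F \<in> D \<Longrightarrow> G \<in> D \<Longrightarrow> \<epsilon>' (F + G) = \<epsilon>' F + \<epsilon>' G"
    and \<epsilon>_scale: "\<And>k F. F \<in> D \<Longrightarrow> \<epsilon>' (fun_scale k F) = k * \<epsilon>' F"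
  shows "coalgebra fun_scale D \<Delta>' \<epsilon>'"
proof -
  have sep: "f = 0" if "f \<in> D" "\<And>a. a \<in> A \<Longrightarrow> f a = 0" for f
    using that unfolding D_def by (rule finite_dual_eq_0)
  have formal: "x \<in> formal (D \<times> D)" if "x \<in> \<Delta>' F" for x F
    using that by (simp add: \<Delta>'_def D_def finite_dual_comult_def)
  have eval: "F (m a b) = lin_ext (*) (\<lambda>(g, h). g a * h b) x" if "x \<in> \<Delta>' F" "a \<in> A" "b \<in> A" for x F a b
    using that by (simp add: \<Delta>'_def finite_dual_comult_def)
  have memI: "x \<in> \<Delta>' F" if "x \<in> formal (D \<times> D)"
      "\<And>a b. a \<in> A \<Longrightarrow> b \<in> A \<Longrightarrow> F (m a b) = lin_ext (*) (\<lambda>(g, h). g a * h b) x" for x F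
    using that by (simp add: \<Delta>'_def D_def finite_dual_comult_def)
  have comult_class: "\<Delta>' F \<in> tensor2 fun_scale D" if F: "F \<in> D" for F
  proof -
    obtain x where x: "x \<in> \<Delta>' F" using ex[OF F] by blast
    have q: "tensor2_eq fun_scale D `` {x} \<in> tensor2 fun_scale D"
      unfolding tensor2_def using formal[OF x] by (rule quotientI)
    have "\<Delta>' F = tensor2_eq fun_scale D `` {x}"
    proof (intro set_eqI iffI)
      fix y assume "y \<in> \<Delta>' F"
      then show "y \<in> tensor2_eq fun_scale D `` {x}"
        using finite_dual_comult_eq[OF D[unfolded D_def]] x by (auto simp: D_def \<Delta>'_def)
    next
      fix y assume y: "y \<in> tensor2_eq fun_scale D `` {x}"
      have x': "x \<in> tensor2_eq fun_scale D `` {x}"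
        using equiv_class_self[OF equiv_tensor2_eq formal[OF x]] .
      show "y \<in> \<Delta>' F"
      proof (rule memI)
        show "y \<in> formal (D \<times> D)" using y by (simp add: tensor2_eq_def)
        fix a b assume ab: "a \<in> A" "b \<in> A"
        have "lin_ext (*) (\<lambda>(g, h). g a * h b) x = lin_ext (*) (\<lambda>(g, h). g a * h b) y"
          by (rule lin_ext_tensor2_cong[OF vector_space_field _ _ q x' y])
             (auto simp: fun_scale_def algebra_simps)
        then show "F (m a b) = lin_ext (*) (\<lambda>(g, h). g a * h b) y"
          using eval[OF x ab] by simp
      qed
    qed
    then show ?thesis using q by simp
  qed
  show ?thesis
  proof (intro coalgebra.intro coalgebra_axioms.intro)
    show "vector_space (fun_scale :: 'k \<Rightarrow> (('x \<Rightarrow> 'k) \<Rightarrow> 'k) \<Rightarrow> _)" by (rule vector_space_fun_scale)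
    show "fun_space.subspace D" by (rule D)
    show "\<Delta>' c \<in> tensor2 fun_scale D" if "c \<in> D" for c using that by (rule comult_class)
    show "x + y \<in> \<Delta>' (a + b)" if "x \<in> \<Delta>' a" "y \<in> \<Delta>' b" for a b x y
      using eval[OF that(1)] eval[OF that(2)] formal[OF that(1)] formal[OF that(2)]
      by (intro memI formal_space.subspace_add formal_subspace) (auto simp: lin_ext_add[OF vector_space_field])
    show "fs_scale k x \<in> \<Delta>' (fun_scale k c)" if "x \<in> \<Delta>' c" for c x k
      using eval[OF that] formal[OF that]
      by (intro memI formal_space.subspace_scale formal_subspace)
         (auto simp: lin_ext_scale[OF vector_space_field] fun_scale_def)
    show "\<epsilon>' (a + b) = \<epsilon>' a + \<epsilon>' b" if "a \<in> D" "b \<in> D" for a b using that by (rule \<epsilon>_add)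
    show "\<epsilon>' (fun_scale k c) = k * \<epsilon>' c" if "c \<in> D" for k c using that by (rule \<epsilon>_scale)
    show "lin_ext fun_scale (\<lambda>(a, b). fun_scale (\<epsilon>' a) b) x = c" if c: "c \<in> D" and x: "x \<in> \<Delta>' c" for c x
    proof -
      obtain y where y: "y \<in> \<Delta>' c" "lin_ext fun_scale (\<lambda>(g, h). fun_scale (\<epsilon>' g) h) y = c"
        using ex[OF c] by blast
      have "lin_ext fun_scale (\<lambda>(a, b). fun_scale (\<epsilon>' a) b) x = lin_ext fun_scale (\<lambda>(a, b). fun_scale (\<epsilon>' a) b) y"
        by (rule lin_ext_tensor2_cong[OF vector_space_fun_scale _ _ comult_class[OF c] x y(1)])
           (auto simp: fun_scale_def \<epsilon>_add \<epsilon>_scale[unfolded fun_scale_def] fun_eq_iff algebra_simps)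
      then show ?thesis using y(2) by simp
    qed
    show "lin_ext fun_scale (\<lambda>(a, b). fun_scale (\<epsilon>' b) a) x = c" if c: "c \<in> D" and x: "x \<in> \<Delta>' c" for c x
    proof -
      obtain y where y: "y \<in> \<Delta>' c" "lin_ext fun_scale (\<lambda>(g, h). fun_scale (\<epsilon>' h) g) y = c"
        using ex[OF c] by blast
      have "lin_ext fun_scale (\<lambda>(a, b). fun_scale (\<epsilon>' b) a) x = lin_ext fun_scale (\<lambda>(a, b). fun_scale (\<epsilon>' b) a) y"
        by (rule lin_ext_tensor2_cong[OF vector_space_fun_scale _ _ comult_class[OF c] x y(1)])
           (auto simp: fun_scale_def \<epsilon>_add \<epsilon>_scale[unfolded fun_scale_def] fun_eq_iff algebra_simps)
      then show ?thesis using y(2) by simp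
    qed
    show "(lin_ext fs_scale (\<lambda>(a, b). lin_ext fs_scale (\<lambda>(a1, a2). gen (a1, a2, b)) (d a)) x,
           lin_ext fs_scale (\<lambda>(a, b). lin_ext fs_scale (\<lambda>(b1, b2). gen (a, b1, b2)) (d b)) x)
          \<in> tensor3_eq fun_scale D" (is "(?L, ?R) \<in> _")
      if x: "x \<in> \<Delta>' F" and d: "\<And>a. a \<in> D \<Longrightarrow> d a \<in> \<Delta>' a" for F x d
    proof -
      have keys: "p \<in> D" "q \<in> D" if "(p, q) \<in> Poly_Mapping.keys x" for p q
        using formal[OF x] that by (auto simp: formal_def)
      have dkeys: "p1 \<in> D" "p2 \<in> D" if "p \<in> D" "(p1, p2) \<in> Poly_Mapping.keys (d p)" for p p1 p2
        using formal[OF d[OF that(1)]] that by (auto simp: formal_def)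
      have L: "?L \<in> formal (D \<times> D \<times> D)"
        by (intro lin_ext_in_formal)
           (auto intro!: lin_ext_in_formal simp: gen_in_formal keys intro: dkeys[OF keys(1)])
      have R: "?R \<in> formal (D \<times> D \<times> D)"
        by (intro lin_ext_in_formal)
           (auto intro!: lin_ext_in_formal simp: gen_in_formal keys intro: dkeys[OF keys(2)])
      have "?L - ?R \<in> formal_space.span (tensor3_rel fun_scale D)"
      proof (rule tensor3_zero[OF D sep])
        show "?L - ?R \<in> formal (D \<times> D \<times> D)"
          using L R by (intro formal_space.subspace_diff formal_subspace)
        fix a b c assume abc: "a \<in> A" "b \<in> A" "c \<in> A"
        let ?ev = "\<lambda>(f, g, h). f a * (g b * h c)"
        have "lin_ext (*) ?ev ?L = lin_ext (*) (\<lambda>(p, q). lin_ext (*) (\<lambda>(p1, p2). p1 a * p2 b * q c) (d p)) x"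
          by (simp add: lin_ext_lin_ext[OF vector_space_field] lin_ext_gen[OF vector_space_field]
              case_prod_unfold mult.assoc)
        also have "\<dots> = lin_ext (*) (\<lambda>(p, q). p (m a b) * q c) x"
          by (rule lin_ext_cong) (auto simp: eval[OF d abc(1,2)] keys lin_ext_mult_right case_prod_unfold)
        also have "\<dots> = F (m (m a b) c)"
          using abc by (simp add: eval[OF x] closed)
        finally have 1: "lin_ext (*) ?ev ?L = F (m (m a b) c)" .
        have "lin_ext (*) ?ev ?R = lin_ext (*) (\<lambda>(p, q). lin_ext (*) (\<lambda>(q1, q2). p a * (q1 b * q2 c)) (d q)) x"
          by (simp add: lin_ext_lin_ext[OF vector_space_field] lin_ext_gen[OF vector_space_field]
              case_prod_unfold)
        also have "\<dots> = lin_ext (*) (\<lambda>(p, q). p a * q (m b c)) x"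
          by (rule lin_ext_cong) (auto simp: eval[OF d abc(2,3)] keys lin_ext_mult_left case_prod_unfold)
        also have "\<dots> = F (m a (m b c))"
          using abc by (simp add: eval[OF x] closed)
        finally show "lin_ext (*) ?ev (?L - ?R) = 0"
          by (simp add: lin_ext_diff[OF vector_space_field] 1 assoc abc)
      qed
      then show ?thesis using L R by (simp add: tensor3_eq_def)
    qed
  qed
qed

section \<open>Evaluation at elements of the Hopf algebra\<close>

context hopf_algebra
begin

text \<open>The value zero outside the rational part follows the convention of \<open>dual_on\<close>.\<close>

definition ev :: "'h \<Rightarrow> ('h \<Rightarrow> 'k) \<Rightarrow> 'k" where
  "ev h a = (if left_rat a then a h else 0)"

lemma lin_ev: "lin fun_scale ev"
  by (rule linI) (auto simp: vector_space_fun_scale ev_def fun_eq_iff fun_scale_def linD[OF left_rat_lin])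

text \<open>
  Those \<open>a\<close> for which all products \<open>f a g\<close> with functionals \<open>f\<close> and \<open>g\<close> vanish at \<open>h\<close> form an ideal,
  which lies in the kernel of \<open>ev h\<close> because \<open>\<epsilon>\<close> is the unit for convolution. It contains all rational
  functionals that vanish on the middle legs of the twofold coproduct of \<open>h\<close>, so it has finite
  codimension.
\<close>

lemma ev_in_finite_dual: "ev h \<in> finite_dual fun_scale (rat_dual s \<Delta>) (conv \<Delta>)"
proof -
  let ?A = "rat_dual s \<Delta>"
  note A = rat_dual_eq
  define I where "I = {a \<in> ?A. \<forall>f g. lin (*) f \<longrightarrow> lin (*) g \<longrightarrow> conv \<Delta> f (conv \<Delta> a g) h = 0}"
  define E where "E = (\<lambda>(p, q). s (Poly_Mapping.lookup (rep (snd p)) q) (fst q)) `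
      (SIGMA p:Poly_Mapping.keys (rep h). Poly_Mapping.keys (rep (snd p)))"
  have "{a \<in> ?A. \<forall>c\<in>E. a c = 0} \<subseteq> I"
    by (auto simp: I_def A conv_eq_sw left_rat_lin sw_def E_def intro!: sum.neutral)
  moreover have "finite E" by (auto simp: E_def)
  ultimately have "finite_codim fun_scale ?A I"
    using finite_codim_vanishing[of ?A E] subspace_left_rat finite_codim_mono by (simp add: A) blast
  moreover have "two_sided_ideal fun_scale ?A (conv \<Delta>) I"
    unfolding two_sided_ideal_def
  proof (intro conjI ballI)
    have apply_scale: "fun_scale k f x = k * f x" for k and f :: "'h \<Rightarrow> 'k" and x
      by (simp add: fun_scale_def)
    show "fun_space.subspace I"
      unfolding I_def
      using fun_space.subspace_0[OF subspace_left_rat] fun_space.subspace_add[OF subspace_left_rat]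
        fun_space.subspace_scale[OF subspace_left_rat]
      by (intro fun_space.subspaceI)
         (auto simp: A left_rat_lin conv_zero_left conv_zero_right conv_add_left conv_add_right
           conv_scale_left conv_scale_right apply_scale)
    show "I \<subseteq> ?A" by (auto simp: I_def)
    fix a x assume "a \<in> ?A" "x \<in> I"
    then have ax: "left_rat a" "left_rat x"
        "\<And>f g. lin (*) f \<Longrightarrow> lin (*) g \<Longrightarrow> conv \<Delta> f (conv \<Delta> x g) h = 0"
      by (auto simp: I_def A)
    note l = left_rat_lin[OF ax(1)] left_rat_lin[OF ax(2)]
    have "conv \<Delta> f (conv \<Delta> (conv \<Delta> a x) g) h = 0" if "lin (*) f" "lin (*) g" for f g
    proof -
      have "conv \<Delta> f (conv \<Delta> (conv \<Delta> a x) g) = conv \<Delta> (conv \<Delta> f a) (conv \<Delta> x g)"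
        using that l by (simp add: conv_assoc lin_conv)
      then show ?thesis using that l by (simp add: ax(3) lin_conv)
    qed
    then show "conv \<Delta> a x \<in> I"
      using ax l by (simp add: I_def A left_rat_conv_left)
    show "conv \<Delta> x a \<in> I"
      using ax l by (simp add: I_def A left_rat_conv_right conv_assoc lin_conv)
  qed
  moreover have "ev h a = 0" if "a \<in> I" for a
  proof -
    have "conv \<Delta> \<epsilon> (conv \<Delta> a \<epsilon>) h = 0" "left_rat a"
      using that lin_counit by (auto simp: I_def A)
    then show ?thesis
      by (simp add: ev_def conv_counit_left conv_counit_right lin_conv left_rat_lin)
  qed
  moreover have "ev h \<in> dual_on fun_scale ?A"
    using subspace_left_rat fun_space.subspace_add fun_space.subspace_scale
    by (fastforce simp: dual_on_def A ev_def fun_scale_def)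
  ultimately show ?thesis unfolding finite_dual_def by blast
qed

text \<open>
  If \<open>F\<close> vanishes on \<open>I\<close>, a left unit \<open>e\<close> modulo \<open>I\<close> gives \<open>F a = F (e a)\<close>. As \<open>e\<close> is right rational,
  this depends on \<open>a\<close> at finitely many points only.
\<close>

lemma finite_dual_eq_range:
  assumes t: "left_integral s \<Delta> t" "t \<noteq> 0"
  shows "finite_dual fun_scale (rat_dual s \<Delta>) (conv \<Delta>) = range ev"
proof (intro set_eqI iffI)
  fix F assume F: "F \<in> finite_dual fun_scale (rat_dual s \<Delta>) (conv \<Delta>)"
  let ?A = "rat_dual s \<Delta>"
  note A = rat_dual_eq
  have sA: "fun_space.subspace ?A" using subspace_left_rat by (simp add: A)
  have Fadd: "F (a + b) = F a + F b" if "a \<in> ?A" "b \<in> ?A" for a b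
    using F that by (simp add: finite_dual_def dual_on_def)
  have Fscale: "F (fun_scale k a) = k * F a" if "a \<in> ?A" for k a
    using F that by (simp add: finite_dual_def dual_on_def)
  have Fout: "F a = 0" if "a \<notin> ?A" for a
    using F that by (simp add: finite_dual_def dual_on_def)
  obtain I where I: "two_sided_ideal fun_scale ?A (conv \<Delta>) I" "finite_codim fun_scale ?A I"
      "\<And>x. x \<in> I \<Longrightarrow> F x = 0"
    using F unfolding finite_dual_def by blast
  have sI: "fun_space.subspace I" "I \<subseteq> ?A" and ideal: "\<And>a x. a \<in> ?A \<Longrightarrow> x \<in> I \<Longrightarrow> conv \<Delta> a x \<in> I"
    using I(1) by (auto simp: two_sided_ideal_def)
  obtain B where B: "finite B" "B \<subseteq> ?A" "?A \<subseteq> fun_space.span (I \<union> B)"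
    using I(2) unfolding finite_codim_def by blast
  obtain e where e: "left_rat e" "\<And>b. b \<in> B \<Longrightarrow> conv \<Delta> e b = b"
    using left_rat_local_units[OF t B(1)] B(2) by (auto simp: A)
  note le = left_rat_lin[OF e(1)]
  have unit: "conv \<Delta> e a - a \<in> I" if "a \<in> ?A" for a
  proof -
    have "a \<in> fun_space.span (I \<union> B)" using that B(3) by blast
    then show ?thesis
    proof (induction rule: fun_space.span_induct_alt)
      case base
      show ?case
        using fun_space.subspace_0[OF sI(1)] by (simp only: conv_zero_right[OF le] diff_zero)
    next
      case (step c x y)
      have "conv \<Delta> e x - x \<in> I"
      proof (cases "x \<in> B")
        case True
        then show ?thesis by (simp add: e(2) fun_space.subspace_0[OF sI(1)])
      next
        case False
        then have "x \<in> I" using step by blast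
        then show ?thesis using ideal e(1) by (intro fun_space.subspace_diff sI) (auto simp: A)
      qed
      then have "fun_scale c (conv \<Delta> e x - x) + (conv \<Delta> e y - y) \<in> I"
        using step by (intro fun_space.subspace_add fun_space.subspace_scale sI)
      moreover have "fun_scale c (conv \<Delta> e x - x) + (conv \<Delta> e y - y)
          = conv \<Delta> e (fun_scale c x + y) - (fun_scale c x + y)"
        by (simp add: conv_add_right conv_scale_right le fun_space.scale_right_diff_distrib algebra_simps)
      ultimately show ?case by (simp only:)
    qed
  qed
  have Fe: "F a = F (conv \<Delta> e a)" if a: "a \<in> ?A" for a
  proof -
    have "F ((conv \<Delta> e a - a) + a) = F (conv \<Delta> e a - a) + F a"
      using unit[OF a] sI(2) a by (intro Fadd) auto
    then show ?thesis using I(3)[OF unit[OF a]] by simp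
  qed
  obtain D where D: "finite D" "\<And>f. lin (*) f \<Longrightarrow> (\<And>c. c \<in> D \<Longrightarrow> f c = 0) \<Longrightarrow> conv \<Delta> e f = 0"
    using right_ratE[OF left_rat_imp_right_rat[OF t e(1)]] by blast
  have "F 0 = 0" using Fscale[of 0 0] fun_space.subspace_0[OF sA] by simp
  then have "\<exists>k. \<forall>a\<in>?A. F a = (\<Sum>d\<in>D. k d * a d)"
    by (intro functional_eq_sum_evaluations[OF sA D(1) Fadd Fscale])
       (auto simp: Fe D(2) A left_rat_lin)
  then obtain k where k: "\<And>a. a \<in> ?A \<Longrightarrow> F a = (\<Sum>d\<in>D. k d * a d)" by blast
  have "F = ev (\<Sum>d\<in>D. s (k d) d)"
  proof
    fix a
    show "F a = ev (\<Sum>d\<in>D. s (k d) d) a"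
      using k[of a] Fout[of a] by (auto simp: ev_def A linD[OF left_rat_lin])
  qed
  then show "F \<in> range ev" by blast
qed (use ev_in_finite_dual in auto)

lemma inj_ev:
  assumes t: "left_integral s \<Delta> t" "t \<noteq> 0"
  shows "inj ev"
proof (rule injI)
  fix x y assume "ev x = ev y"
  then have "a x = a y" if "left_rat a" for a
    using that by (auto simp: ev_def dest: fun_cong[of _ _ a])
  then have *: "t (g * x) = t (g * y)" for g using left_rat_integral[OF t(1)] by blast
  interpret L: Vector_Spaces.linear s "(*)" t by (rule integral_lin[OF t(1)])
  have "x - y = 0"
    by (rule integral_left_separates[OF t]) (simp add: right_diff_distrib L.diff *)
  then show "x = y" by simp
qed

lemma ev_comult:
  assumes x: "x \<in> \<Delta> h"
  shows "lin_ext fs_scale (\<lambda>(a, b). gen (ev a, ev b)) x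
    \<in> finite_dual_comult fun_scale (rat_dual s \<Delta>) (conv \<Delta>) (ev h)"
  unfolding finite_dual_comult_def
proof (intro CollectI conjI ballI)
  show "lin_ext fs_scale (\<lambda>(a, b). gen (ev a, ev b)) x
      \<in> formal (finite_dual fun_scale (rat_dual s \<Delta>) (conv \<Delta>) \<times> finite_dual fun_scale (rat_dual s \<Delta>) (conv \<Delta>))"
    by (rule lin_ext_in_formal) (auto simp: gen_in_formal ev_in_finite_dual)
  fix f g assume "f \<in> rat_dual s \<Delta>" "g \<in> rat_dual s \<Delta>"
  then have fg: "left_rat f" "left_rat g" by (simp_all add: rat_dual_eq)
  note l = left_rat_lin[OF fg(1)] left_rat_lin[OF fg(2)]
  have "ev h (conv \<Delta> f g) = sw h (\<lambda>a b. f a * g b)"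
    by (simp add: ev_def left_rat_conv_left fg l conv_eq_sw)
  also have "\<dots> = lin_ext (*) (\<lambda>(a, b). f a * g b) x"
    by (rule lin_sw_ext[symmetric, OF _ _ x]) (intro lin_intros l)+
  also have "\<dots> = lin_ext (*) (\<lambda>(p, q). p f * q g) (lin_ext fs_scale (\<lambda>(a, b). gen (ev a, ev b)) x)"
    by (simp add: lin_ext_lin_ext[OF vector_space_field] lin_ext_gen[OF vector_space_field]
        case_prod_unfold ev_def fg)
  finally show "ev h (conv \<Delta> f g)
    = lin_ext (*) (\<lambda>(p, q). p f * q g) (lin_ext fs_scale (\<lambda>(a, b). gen (ev a, ev b)) x)" .
qed

lemma coalgebra_iso_finite_dual:
  assumes t: "left_integral s \<Delta> t" "t \<noteq> 0"
  shows "\<exists>\<epsilon>' \<phi>.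
      coalgebra fun_scale
        (finite_dual fun_scale (rat_dual s \<Delta>) (conv \<Delta>))
        (finite_dual_comult fun_scale (rat_dual s \<Delta>) (conv \<Delta>)) \<epsilon>'
    \<and> coalgebra_iso s UNIV \<Delta> \<epsilon> fun_scale
        (finite_dual fun_scale (rat_dual s \<Delta>) (conv \<Delta>))
        (finite_dual_comult fun_scale (rat_dual s \<Delta>) (conv \<Delta>)) \<epsilon>' \<phi>"
proof (intro exI conjI)
  \<comment> \<open>The counit of the finite dual is transported along \<open>ev\<close>; it takes the value \<open>\<epsilon> h\<close> at \<open>ev h\<close>.\<close>
  let ?\<epsilon> = "\<lambda>F. \<epsilon> (inv ev F)"
  have \<epsilon>: "?\<epsilon> (ev h) = \<epsilon> h" for h using inj_ev[OF t] by simp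
  note ran = finite_dual_eq_range[OF t]
  note ev_eq = linD[OF lin_ev]
  interpret E: Vector_Spaces.linear s fun_scale ev by (rule lin_ev)
  show "coalgebra fun_scale (finite_dual fun_scale (rat_dual s \<Delta>) (conv \<Delta>))
        (finite_dual_comult fun_scale (rat_dual s \<Delta>) (conv \<Delta>)) ?\<epsilon>"
  proof (rule coalgebra_finite_dual)
    show "conv \<Delta> a b \<in> rat_dual s \<Delta>" if "a \<in> rat_dual s \<Delta>" "b \<in> rat_dual s \<Delta>" for a b
      using that by (simp add: rat_dual_eq left_rat_conv_left left_rat_lin)
    show "conv \<Delta> (conv \<Delta> a b) c = conv \<Delta> a (conv \<Delta> b c)"
      if "a \<in> rat_dual s \<Delta>" "b \<in> rat_dual s \<Delta>" "c \<in> rat_dual s \<Delta>" for a b c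
      using that by (simp add: rat_dual_eq conv_assoc left_rat_lin)
    show "fun_space.subspace (finite_dual fun_scale (rat_dual s \<Delta>) (conv \<Delta>))"
      unfolding ran by (rule E.subspace_image) simp
    fix F assume "F \<in> finite_dual fun_scale (rat_dual s \<Delta>) (conv \<Delta>)"
    then obtain h where h: "F = ev h" unfolding ran by blast
    let ?x = "lin_ext fs_scale (\<lambda>(a, b). gen (ev a, ev b)) (rep h)"
    have "lin_ext fun_scale (\<lambda>(f, g). fun_scale (?\<epsilon> f) g) ?x = lin_ext fun_scale (\<lambda>(a, b). ev (s (\<epsilon> a) b)) (rep h)"
      by (simp add: lin_ext_lin_ext[OF vector_space_fun_scale] lin_ext_gen[OF vector_space_fun_scale]
          case_prod_unfold \<epsilon> ev_eq(2))
    also have "\<dots> = ev h"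
      by (subst lin_sw_ext[OF _ _ rep_mem])
         (auto intro!: lin_comp[OF lin_ev] lin_intros simp: sw_counit1[OF lin_ev])
    finally have 1: "lin_ext fun_scale (\<lambda>(f, g). fun_scale (?\<epsilon> f) g) ?x = F" using h by simp
    have "lin_ext fun_scale (\<lambda>(f, g). fun_scale (?\<epsilon> g) f) ?x = lin_ext fun_scale (\<lambda>(a, b). ev (s (\<epsilon> b) a)) (rep h)"
      by (simp add: lin_ext_lin_ext[OF vector_space_fun_scale] lin_ext_gen[OF vector_space_fun_scale]
          case_prod_unfold \<epsilon> ev_eq(2))
    also have "\<dots> = ev h"
      by (subst lin_sw_ext[OF _ _ rep_mem])
         (auto intro!: lin_comp[OF lin_ev] lin_intros simp: sw_counit2[OF lin_ev])
    finally have 2: "lin_ext fun_scale (\<lambda>(f, g). fun_scale (?\<epsilon> g) f) ?x = F" using h by simp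
    show "\<exists>x\<in>finite_dual_comult fun_scale (rat_dual s \<Delta>) (conv \<Delta>) F.
        lin_ext fun_scale (\<lambda>(g, h). fun_scale (?\<epsilon> g) h) x = F \<and>
        lin_ext fun_scale (\<lambda>(g, h). fun_scale (?\<epsilon> h) g) x = F"
      using ev_comult[OF rep_mem, of h] 1 2 h by (intro bexI[of _ ?x]) auto
    show "?\<epsilon> (fun_scale k F) = k * ?\<epsilon> F" for k
      using \<epsilon>[of "s k h"] by (simp add: h \<epsilon> ev_eq(2) counit_scale)
    fix G assume "G \<in> finite_dual fun_scale (rat_dual s \<Delta>) (conv \<Delta>)"
    then obtain g where g: "G = ev g" unfolding ran by blast
    show "?\<epsilon> (F + G) = ?\<epsilon> F + ?\<epsilon> G"
      using \<epsilon>[of "h + g"] unfolding g h ev_eq(1) by (simp add: \<epsilon> counit_add)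
  qed
  show "coalgebra_iso s UNIV \<Delta> \<epsilon> fun_scale (finite_dual fun_scale (rat_dual s \<Delta>) (conv \<Delta>))
        (finite_dual_comult fun_scale (rat_dual s \<Delta>) (conv \<Delta>)) ?\<epsilon> ev"
    unfolding coalgebra_iso_def
    using inj_ev[OF t] by (auto simp: ran bij_betw_def ev_eq(1,2) \<epsilon> ev_comult)
qed

end

theorem corollary4p8:
  fixes s :: "'k::field \<Rightarrow> 'h::ring_1 \<Rightarrow> 'h"
    and \<Delta> :: "'h \<Rightarrow> ('h \<times> 'h \<Rightarrow>\<^sub>0 'k) set"
    and \<epsilon> :: "'h \<Rightarrow> 'k"
    and S :: "'h \<Rightarrow> 'h"
  assumes "hopf_algebra s \<Delta> \<epsilon> S"
    and "has_nonzero_integrals s \<Delta>"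
  shows "\<exists>\<epsilon>' \<phi>.
      coalgebra fun_scale
        (finite_dual fun_scale (rat_dual s \<Delta>) (conv \<Delta>))
        (finite_dual_comult fun_scale (rat_dual s \<Delta>) (conv \<Delta>)) \<epsilon>'
    \<and> coalgebra_iso s UNIV \<Delta> \<epsilon> fun_scale
        (finite_dual fun_scale (rat_dual s \<Delta>) (conv \<Delta>))
        (finite_dual_comult fun_scale (rat_dual s \<Delta>) (conv \<Delta>)) \<epsilon>' \<phi>"
proof -
  interpret hopf_algebra s \<Delta> \<epsilon> S by fact
  obtain t where "left_integral s \<Delta> t" "t \<noteq> 0"
    using assms(2) by (auto simp: has_nonzero_integrals_def)
  then show ?thesis by (rule coalgebra_iso_finite_dual)
qed

end
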